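(* Let $\boldsymbol l=(l_1,l_2)=(2,1)$ and let $m_1,m_2,k$ be such that $\boldsymbol m=(m_1,m_2),\boldsymbol l,k$ are consistent and $$(2m_1+m_2)^2+k\,(4m_1-m_2^2)=0 .$$ Then $y_1(x)=y_2(x)^2$, and the roots of these two polynomials do not form a solution of the system $(B)$. Hence the system $(B)$ of equations $$\frac{m_1}{t_i}+\frac{k}{t_i-1}-\frac{2}{t_i-t_{3-i}}+\frac{1}{t_i-s_1}=0\quad(i=1,2),\qquad \frac{m_2}{s_1}+\frac1{s_1-t_1}+\frac1{s_1-t_2}=0 \tag{B}$$ has no solution $(t_1,t_2,s_1)\in\mathbb C^3$ (where all denominators are required to be non-zero). Hence there is no Bethe vector generating the one-dimensional space $\mathrm{Sing}\,(L_{\Lambda_1}\otimes L_{\Lambda_2})[\mu]$, where $\mu=\Lambda_1+\Lambda_2-2\alpha_1-\alpha_2$.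
   Context: Parameters $\boldsymbol m=(m_1,m_2)$, $\boldsymbol l=(l_1,l_2)$, $k$ (non-negative integers) are consistent if $k\ge l_1\ge l_2\ge 0$, $m_1\ge l_1-l_2$, $m_2\ge l_2$. Put $e_0=l_1$, $e_1=m_1+1+k+l_2-l_1$, $e_2=m_1+m_2+2+k-l_2$. For consistent parameters $V(\boldsymbol l,k)$ is the unique three-dimensional complex vector space of polynomials in $x$ such that the set of degrees of its non-zero elements is $\{e_0<e_1<e_2\}$, the set of orders of vanishing at $x=0$ of its non-zero elements is $\{0,m_1+1,m_1+m_2+2\}$, and the set of orders of vanishing at $x=1$ is $\{0,k+1,k+2\}$ (existence and uniqueness are known). Let $f_0,f_1\in V(\boldsymbol l,k)$ be monic polynomials of degrees $e_0,e_1$. Define the monic polynomials $$y_1=f_0,\qquad y_2=\frac{f_0f_1'-f_0'f_1}{(e_1-e_0)\,x^{m_1}(x-1)^k}$$ of degrees $l_1$ and $l_2$ respectively. The roots of $y_1,y_2$ (with multiplicity) are to be substituted for $(t_1,t_2)$ and $s_1$ in $(B)$. $\alpha_1,\alpha_2$ are the simple roots of $sl_3$, $(\cdot,\cdot)$ is the invariant form with $(\alpha_i,\alpha_i)=2$, and $\Lambda_1,\Lambda_2$ are the weights with $(\Lambda_1,\alpha_1)=m_1$, $(\Lambda_1,\alpha_2)=m_2$, $(\Lambda_2,\alpha_1)=k$, $(\Lambda_2,\alpha_2)=0$. $L_\Lambda$ is the irreducible $sl_3$-module with highest weight $\Lambda$; $\mathrm{Sing}\,M[\mu]$ is the space of vectors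 of weight $\mu$ in $M$ annihilated by $\mathfrak n_+$. System $(B)$ is the Bethe Ansatz equation of the Gaudin model associated to $L_{\Lambda_1}\otimes L_{\Lambda_2}$, the points $z_1=0,z_2=1$ and the weight $\mu$. A Bethe vector is, by definition, the value at a solution of $(B)$ of a certain rational function (the canonical weight function) with values in $(L_{\Lambda_1}\otimes L_{\Lambda_2})[\mu]$; so Bethe vectors correspond to solutions of $(B)$. *)

theory Defs
  imports "HOL-Analysis.Analysis" "HOL-Computational_Algebra.Computational_Algebra"
begin

unbundle no fps_syntax

section \<open>The polynomial spaces and the pair of polynomials\<close>

definition consistent :: "nat \<Rightarrow> nat \<Rightarrow> nat \<Rightarrow> nat \<Rightarrow> nat \<Rightarrow> bool" where
  "consistent m1 m2 l1 l2 k \<longleftrightarrow> k \<ge> l1 \<and> l1 \<ge> l2 \<and> m1 \<ge> l1 - l2 \<and> m2 \<ge> l2"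

text \<open>The truncated subtractions below are exact for consistent parameters.\<close>

definition exp0 :: "nat \<Rightarrow> nat \<Rightarrow> nat \<Rightarrow> nat \<Rightarrow> nat \<Rightarrow> nat" where
  "exp0 m1 m2 l1 l2 k = l1"

definition exp1 :: "nat \<Rightarrow> nat \<Rightarrow> nat \<Rightarrow> nat \<Rightarrow> nat \<Rightarrow> nat" where
  "exp1 m1 m2 l1 l2 k = m1 + 1 + k + l2 - l1"

definition exp2 :: "nat \<Rightarrow> nat \<Rightarrow> nat \<Rightarrow> nat \<Rightarrow> nat \<Rightarrow> nat" where
  "exp2 m1 m2 l1 l2 k = m1 + m2 + 2 + k - l2"

text \<open>The defining property of the space \<open>V(l, k)\<close>; for consistent parameters there is
  exactly one such space.\<close>

definition is_V_space ::
  "nat \<Rightarrow> nat \<Rightarrow> nat \<Rightarrow> nat \<Rightarrow> nat \<Rightarrow> complex poly set \<Rightarrow> bool" where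
  "is_V_space m1 m2 l1 l2 k V \<longleftrightarrow>
     module.subspace smult V \<and> vector_space.dim smult V = 3 \<and>
     degree ` (V - {0}) = {exp0 m1 m2 l1 l2 k, exp1 m1 m2 l1 l2 k, exp2 m1 m2 l1 l2 k} \<and>
     order 0 ` (V - {0}) = {0, m1 + 1, m1 + m2 + 2} \<and>
     order 1 ` (V - {0}) = {0, k + 1, k + 2}"

definition y1_poly :: "complex poly \<Rightarrow> complex poly \<Rightarrow> complex poly" where
  "y1_poly f0 f1 = f0"

text \<open>If \<open>f0\<close>, \<open>f1\<close> lie in \<open>V(l, k)\<close>, the orders of vanishing at 0 and 1 make this
  polynomial division exact.  Since \<open>f1\<close> is determined only up to adding a multiple of \<open>f0\<close>,
  the quotient does not depend on the choice of \<open>f1\<close>.\<close>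

definition y2_poly ::
  "nat \<Rightarrow> nat \<Rightarrow> nat \<Rightarrow> nat \<Rightarrow> nat \<Rightarrow> complex poly \<Rightarrow> complex poly \<Rightarrow> complex poly" where
  "y2_poly m1 m2 l1 l2 k f0 f1 =
     (f0 * pderiv f1 - pderiv f0 * f1) div
     smult (of_nat (exp1 m1 m2 l1 l2 k) - of_nat (exp0 m1 m2 l1 l2 k))
       ([:0, 1:] ^ m1 * [:-1, 1:] ^ k)"


section \<open>The Bethe Ansatz equations for \<open>l = (2, 1)\<close>\<close>

definition bethe_solution ::
  "nat \<Rightarrow> nat \<Rightarrow> nat \<Rightarrow> complex \<Rightarrow> complex \<Rightarrow> complex \<Rightarrow> bool" where
  "bethe_solution m1 m2 k t1 t2 s \<longleftrightarrow>
     t1 \<noteq> 0 \<and> t2 \<noteq> 0 \<and> t1 \<noteq> 1 \<and> t2 \<noteq> 1 \<and> t1 \<noteq> t2 \<and> t1 \<noteq> s \<and> t2 \<noteq> s \<and> s \<noteq> 0 \<and>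
     of_nat m1 / t1 + of_nat k / (t1 - 1) - 2 / (t1 - t2) + 1 / (t1 - s) = 0 \<and>
     of_nat m1 / t2 + of_nat k / (t2 - 1) - 2 / (t2 - t1) + 1 / (t2 - s) = 0 \<and>
     of_nat m2 / s + 1 / (s - t1) + 1 / (s - t2) = 0"

definition roots_form_bethe_solution ::
  "nat \<Rightarrow> nat \<Rightarrow> nat \<Rightarrow> complex poly \<Rightarrow> complex poly \<Rightarrow> bool" where
  "roots_form_bethe_solution m1 m2 k y1 y2 \<longleftrightarrow>
     (\<exists>t1 t2 s. proots y1 = {#t1, t2#} \<and> proots y2 = {#s#} \<and> bethe_solution m1 m2 k t1 t2 s)"


section \<open>Representations of \<open>sl\<^sub>3\<close>\<close>

definition sl3 :: "(complex^3^3) set" where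
  "sl3 = {X. trace X = 0}"

definition unit_matrix :: "3 \<Rightarrow> 3 \<Rightarrow> complex^3^3" where
  "unit_matrix p q = (\<chi> i j. if i = p \<and> j = q then 1 else 0)"

text \<open>Simple roots are indexed by the type \<open>2\<close>.  In the types \<open>2\<close> and \<open>3\<close> the numerals are
  residues (for instance \<open>3 = 0\<close> in type \<open>3\<close>), so no order on them is used.\<close>

definition chevalley_E :: "2 \<Rightarrow> complex^3^3" where
  "chevalley_E i = (if i = 1 then unit_matrix 1 2 else unit_matrix 2 3)"

definition chevalley_F :: "2 \<Rightarrow> complex^3^3" where
  "chevalley_F i = (if i = 1 then unit_matrix 2 1 else unit_matrix 3 2)"

definition chevalley_H :: "2 \<Rightarrow> complex^3^3" where
  "chevalley_H i = chevalley_E i ** chevalley_F i - chevalley_F i ** chevalley_E i"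

definition n_plus :: "(complex^3^3) set" where
  "n_plus = {X. \<forall>i j. X $ i $ j \<noteq> 0 \<longrightarrow> (i, j) \<in> {(1, 2), (1, 3), (2, 3)}}"

text \<open>An integral weight \<open>\<mu>\<close> is encoded by the vector of the numbers \<open>(\<mu>, \<alpha>\<^sub>1)\<close>, \<open>(\<mu>, \<alpha>\<^sub>2)\<close>.
  As \<open>(\<alpha>\<^sub>i, \<alpha>\<^sub>i) = 2\<close>, the number \<open>(\<mu>, \<alpha>\<^sub>i)\<close> is also the value of \<open>\<mu>\<close> on the coroot \<open>H\<^sub>i\<close>.\<close>

definition simple_root :: "2 \<Rightarrow> int^2" where
  "simple_root i = (\<chi> j. if j = i then 2 else -1)"

text \<open>The matrix product \<open>mat c ** X\<close> is the scalar multiple of \<open>X\<close> by \<open>c\<close>.\<close>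

definition sl3_rep :: "(complex^3^3 \<Rightarrow> complex^'n^'n) \<Rightarrow> bool" where
  "sl3_rep \<rho> \<longleftrightarrow>
     (\<forall>X\<in>sl3. \<forall>Y\<in>sl3. \<rho> (X + Y) = \<rho> X + \<rho> Y) \<and>
     (\<forall>c. \<forall>X\<in>sl3. \<rho> (mat c ** X) = mat c ** \<rho> X) \<and>
     (\<forall>X\<in>sl3. \<forall>Y\<in>sl3. \<rho> (X ** Y - Y ** X) = \<rho> X ** \<rho> Y - \<rho> Y ** \<rho> X)"

definition irreducible_rep :: "(complex^3^3 \<Rightarrow> complex^'n^'n) \<Rightarrow> bool" where
  "irreducible_rep \<rho> \<longleftrightarrow> sl3_rep \<rho> \<and>
     (\<forall>W. vec.subspace W \<and> (\<forall>X\<in>sl3. \<forall>w\<in>W. \<rho> X *v w \<in> W) \<longrightarrow> W = {0} \<or> W = UNIV)"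

definition weight_space :: "(complex^3^3 \<Rightarrow> complex^'n^'n) \<Rightarrow> int^2 \<Rightarrow> (complex^'n) set" where
  "weight_space \<rho> \<mu> = {u. \<forall>i. \<rho> (chevalley_H i) *v u = of_int (\<mu> $ i) *s u}"

definition Sing :: "(complex^3^3 \<Rightarrow> complex^'n^'n) \<Rightarrow> int^2 \<Rightarrow> (complex^'n) set" where
  "Sing \<rho> \<mu> = {u \<in> weight_space \<rho> \<mu>. \<forall>X\<in>n_plus. \<rho> X *v u = 0}"

text \<open>For dominant integral \<open>\<Lambda>\<close> the module \<open>L\<^sub>\<Lambda>\<close> is finite-dimensional, hence realised (uniquely
  up to isomorphism) on some \<open>complex^'n\<close>.\<close>

definition is_L :: "int^2 \<Rightarrow> (complex^3^3 \<Rightarrow> complex^'n^'n) \<Rightarrow> complex^'n \<Rightarrow> bool" where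
  "is_L \<Lambda> \<rho> v \<longleftrightarrow> irreducible_rep \<rho> \<and> v \<noteq> 0 \<and> v \<in> Sing \<rho> \<Lambda>"

text \<open>The tensor product of \<open>complex^'n\<close> and \<open>complex^'m\<close> is \<open>complex^('n \<times> 'm)\<close>; the
  action on it is \<open>\<rho>\<^sub>1(X) \<otimes> 1 + 1 \<otimes> \<rho>\<^sub>2(X)\<close>, written out as a matrix.\<close>

definition tensor_vec :: "complex^'n \<Rightarrow> complex^'m \<Rightarrow> complex^('n \<times> 'm)" where
  "tensor_vec v w = (\<chi> p. v $ fst p * w $ snd p)"

definition tensor_rep ::
  "(complex^3^3 \<Rightarrow> complex^'n^'n) \<Rightarrow> (complex^3^3 \<Rightarrow> complex^'m^'m) \<Rightarrow>
   complex^3^3 \<Rightarrow> complex^('n \<times> 'm)^('n \<times> 'm)" where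
  "tensor_rep \<rho>1 \<rho>2 X = (\<chi> p q.
     \<rho>1 X $ fst p $ fst q * (if snd p = snd q then 1 else 0) +
     (if fst p = fst q then 1 else 0) * \<rho>2 X $ snd p $ snd q)"


section \<open>The canonical weight function and Bethe vectors\<close>

text \<open>Variables are numbered by naturals: variable \<open>a\<close> has value \<open>x a\<close> and belongs to the simple
  root \<open>c a\<close>.  A word \<open>a\<^sub>1, \<dots>, a\<^sub>j\<close> of variables attached to the point \<open>z\<close> contributes the factor
  \<open>1 / ((x a\<^sub>1 - x a\<^sub>2) \<cdots> (x a\<^sub>j\<^sub>-\<^sub>1 - x a\<^sub>j) (x a\<^sub>j - z))\<close> and the vector
  \<open>F\<^sub>c\<^sub>(\<^sub>a\<^sub>1\<^sub>) \<cdots> F\<^sub>c\<^sub>(\<^sub>a\<^sub>j\<^sub>) v\<close>.\<close>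

fun chain_fraction :: "(nat \<Rightarrow> complex) \<Rightarrow> complex \<Rightarrow> nat list \<Rightarrow> complex" where
  "chain_fraction x z [] = 1"
| "chain_fraction x z [a] = 1 / (x a - z)"
| "chain_fraction x z (a # b # as) = 1 / (x a - x b) * chain_fraction x z (b # as)"

definition F_word ::
  "(complex^3^3 \<Rightarrow> complex^'n^'n) \<Rightarrow> (nat \<Rightarrow> 2) \<Rightarrow> nat list \<Rightarrow> complex^'n \<Rightarrow> complex^'n" where
  "F_word \<rho> c as v = foldr (\<lambda>a u. \<rho> (chevalley_F (c a)) *v u) as v"

text \<open>The usual sum over index sequences \<open>I\<close> and over bijections from the positions of \<open>I\<close> to the
  variables of the matching simple root is the sum over all ways of arranging the \<open>N\<close> variables
  into two words, one for each point.\<close>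

definition weight_function ::
  "(complex^3^3 \<Rightarrow> complex^'n^'n) \<Rightarrow> complex^'n \<Rightarrow> complex \<Rightarrow>
   (complex^3^3 \<Rightarrow> complex^'m^'m) \<Rightarrow> complex^'m \<Rightarrow> complex \<Rightarrow>
   nat \<Rightarrow> (nat \<Rightarrow> 2) \<Rightarrow> (nat \<Rightarrow> complex) \<Rightarrow> complex^('n \<times> 'm)" where
  "weight_function \<rho>1 v1 z1 \<rho>2 v2 z2 N c x =
     (\<Sum>(as, bs)\<in>{(as, bs). distinct (as @ bs) \<and> set (as @ bs) = {..<N}}.
        (chain_fraction x z1 as * chain_fraction x z2 bs) *s
        tensor_vec (F_word \<rho>1 c as v1) (F_word \<rho>2 c bs v2))"

text \<open>A solution may have \<open>s = 1\<close>, as \<open>(\<Lambda>\<^sub>2, \<alpha>\<^sub>2) = 0\<close>.  The terms of the weight function with the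
  denominator \<open>s - 1\<close> contain the zero vector \<open>F\<^sub>2 v\<^sub>2\<close>, so this is harmless.\<close>

definition is_bethe_vector ::
  "nat \<Rightarrow> nat \<Rightarrow> nat \<Rightarrow>
   (complex^3^3 \<Rightarrow> complex^'n^'n) \<Rightarrow> complex^'n \<Rightarrow>
   (complex^3^3 \<Rightarrow> complex^'m^'m) \<Rightarrow> complex^'m \<Rightarrow> complex^('n \<times> 'm) \<Rightarrow> bool" where
  "is_bethe_vector m1 m2 k \<rho>1 v1 \<rho>2 v2 u \<longleftrightarrow>
     (\<exists>t1 t2 s. bethe_solution m1 m2 k t1 t2 s \<and>
        u = weight_function \<rho>1 v1 0 \<rho>2 v2 1 3 (nth [1, 1, 2]) (nth [t1, t2, s]))"

end

theory Submission
  imports Defs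
begin

text \<open>
  \<^bold>\<open>No solution of the Bethe equations.\<close>  Symmetrizing the equations in the two unknowns \<open>t1\<close>, \<open>t2\<close> reduces
  the system to a quadratic equation for \<open>s\<close>.  One root is always spurious: it corresponds to the collision
  \<open>t1 = t2 = s\<close>.  The condition on the parameters is the condition that the other root coincides with it
  (\<open>no_bethe_solution\<close>).

  \<^bold>\<open>The polynomials.\<close>  The orders of vanishing at 0 and 1 determine the Wronskian of \<open>f0\<close> and \<open>f1\<close> up to a
  constant and one linear factor \<open>x - s\<close>, which is \<open>y2\<close>.  If \<open>f0\<close> had
  distinct roots, these roots and \<open>s\<close> would satisfy the Bethe equations: the equations for the roots of \<open>f0\<close> come
  from the Wronskian of \<open>f0\<close> and \<open>f1\<close> (\<open>bethe_equation_first_root\<close>), the equation for \<open>s\<close> from the Wronskian of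
  two Wronskians (\<open>bethe_equation_second_root\<close>).  As there is no solution, \<open>f0\<close> has a double root, and this
  root must be \<open>s\<close>.  So the identity \<open>y1 = y2^2\<close> is a consequence of the insolvability, without any computation of \<open>V\<close>.

  \<^bold>\<open>The space of singular vectors.\<close>  Without a solution there is no Bethe vector, and it remains to see that
  \<open>Sing\<close> is a line.  Existence is an explicit vector (\<open>singular_vector\<close>).  For uniqueness, a singular
  vector is determined by its contraction with the functional \<open>\<phi>\<close> dual to the highest weight vector of the first
  factor, since the raising operators generate the dual module from \<open>\<phi>\<close> (\<open>zero_if_E_words_vanish\<close>).  The contraction
  lies in a weight space of the second factor that is spanned by one vector, because \<open>F 2\<close> kills the highest
  weight vector there (\<open>weight_vector_depth_21\<close>).
\<close>

section \<open>The Bethe equations\<close>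

text \<open>Write \<open>E1\<close>, \<open>E2\<close>, \<open>E3\<close> for the left-hand sides of the three equations.  The pairwise poles cancel in
  \<open>t1 * E1 + t2 * E2 + s * E3\<close> and in \<open>t1^2 * E1 + t2^2 * E2 + s^2 * E3\<close>, and what remains is symmetric in
  \<open>t1\<close>, \<open>t2\<close>.  These two combinations give the first two identities; the third is \<open>E3\<close> cleared of its
  denominators.\<close>
lemma symmetrized_bethe_system:
  fixes m1 m2 k t1 t2 s :: complex
  assumes nz: "t1 \<noteq> 0" "t2 \<noteq> 0" "t1 \<noteq> 1" "t2 \<noteq> 1" "t1 \<noteq> t2" "t1 \<noteq> s" "t2 \<noteq> s" "s \<noteq> 0"
    and e1: "m1 / t1 + k / (t1 - 1) - 2 / (t1 - t2) + 1 / (t1 - s) = 0"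
    and e2: "m1 / t2 + k / (t2 - 1) - 2 / (t2 - t1) + 1 / (t2 - s) = 0"
    and e3: "m2 / s + 1 / (s - t1) + 1 / (s - t2) = 0"
  shows "(2*m1+m2+2*k) * (1 - (t1+t2) + t1*t2) + k * (t1+t2-2) = 0"
    and "(m1+k-1) * (t1+t2) + (m2+2) * s = 2*m1+m2"
    and "(m2+2) * s^2 - (m2+1) * (t1+t2) * s + m2 * (t1*t2) = 0"
proof -
  define p q r u1 u2 where "p = 1/(t1-1)" and "q = 1/(t2-1)" and "r = 1/(t1-t2)"
    and "u1 = 1/(t1-s)" and "u2 = 1/(t2-s)"
  have pq: "p * (t1-1) = 1" "q * (t2-1) = 1" "r * (t1-t2) = 1" "u1 * (t1-s) = 1" "u2 * (t2-s) = 1"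
    using nz by (simp_all add: p_def q_def r_def u1_def u2_def)
  have neg: "2/(t2-t1) = - 2 * r" "1/(s-t1) = - u1" "1/(s-t2) = -u2" 
    using nz by (simp_all add: r_def u1_def u2_def divide_simps)
  have "m1 / t1 + k*p - 2*r + u1 = 0" "m1 / t2 + k*q + 2*r + u2 = 0" "m2 / s - u1 - u2 = 0"
    using e1 e2 e3 unfolding neg by (simp_all add: p_def q_def r_def u1_def u2_def)
  hence E: "m1 / t1 = - (k*p) + 2*r - u1" "m1 / t2 = - (k*q) - 2*r - u2" "m2 / s = u1 + u2"
    by (auto simp: algebra_simps eq_neg_iff_add_eq_0)
  have M1: "m1 = t1 * (- (k*p) + 2*r - u1)" "m1 = t2 * (- (k*q) - 2*r - u2)" "m2 = s * (u1+u2)"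
    unfolding E[symmetric] using nz by simp_all
  have S1: "2*m1+m2+2*k + k * (p+q) = 0"
  proof -
    have "2*m1+m2 = t1 * (- (k*p) + 2*r - u1) + t2 * (- (k*q) - 2*r - u2) + s * (u1+u2)"
      using M1 by (metis mult_2)
    hence "2*m1+m2+2*k + k*(p+q) = k * (1 - p*(t1-1)) + k*(1-q*(t2-1)) + 2 * (r*(t1-t2)) - u1*(t1-s) - u2*(t2-s)"
      by (simp add: algebra_simps)
    thus ?thesis by (simp add: pq)
  qed
  have P: "(p+q) * (1 - (t1+t2) + t1*t2) = t1+t2-2"
  proof -
    have "(p+q) * (1 - (t1+t2) + t1*t2) = (p*(t1-1))*(t2-1) + (q*(t2-1))*(t1-1)"
      by (simp add: algebra_simps)
    thus ?thesis by (simp add: pq)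
  qed
  have "(2*m1+m2+2*k) * (1 - (t1+t2) + t1*t2) + k * (t1+t2-2)
      = (2*m1+m2+2*k + k * (p+q)) * (1 - (t1+t2) + t1*t2)"
    by (simp only: P[symmetric]) (simp add: algebra_simps)
  thus "(2*m1+m2+2*k) * (1 - (t1+t2) + t1*t2) + k * (t1+t2-2) = 0"
    using S1 by simp
  have "m1*t1 + m1*t2 + m2* s = t1 * (- (k*p) + 2*r - u1)*t1 + t2 * (- (k*q) - 2*r - u2)*t2 + s * (u1+u2)* s"
    using M1 by metis
  also have "... = - k*(p*(t1-1)*(t1+1) + p) - k*(q*(t2-1)*(t2+1)+q) 
      + 2*(r*(t1-t2))*(t1+t2) - u1*(t1-s)*(t1+s) - u2*(t2-s)*(t2+s)"
    by (simp add: algebra_simps)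
  also have "... = - k*(t1+1+p) - k*(t2+1+q) + 2*(t1+t2) - (t1+s) - (t2+s)" by (simp add: pq)
  finally have A: "m1*t1 + m1*t2 + m2* s = - k*(t1+1+p) - k*(t2+1+q) + 2*(t1+t2) - (t1+s) - (t2+s)" .
  have "(m1+k-1) * (t1+t2) + (m2+2) * s - (2*m1+m2)
      = (m1*t1 + m1*t2 + m2* s) + k*(t1+1+p) + k*(t2+1+q) - (t1+t2) + 2* s - (2*m1+m2+2*k + k * (p+q))"
    by (simp add: algebra_simps)
  thus "(m1+k-1) * (t1+t2) + (m2+2) * s = 2*m1+m2"
    unfolding A S1 by (simp add: algebra_simps)
  have "m2 * ((t1-s)*(t2-s)) = s * ((u1*(t1-s))*(t2-s) + (u2*(t2-s))*(t1-s))"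
    by (subst M1(3)) (simp add: algebra_simps)
  hence "m2 * ((t1-s)*(t2-s)) = s * ((t2-s) + (t1-s))" by (simp only: pq mult_1)
  thus "(m2+2) * s^2 - (m2+1) * (t1+t2) * s + m2 * (t1*t2) = 0"
    by (simp add: algebra_simps power2_eq_square)
qed

text \<open>Eliminating \<open>a = t1 + t2\<close> and \<open>b = t1 * t2\<close> leaves a quadratic equation for \<open>s\<close>.  One of its roots is
  \<open>s = M / N\<close>, for which \<open>t1 = t2 = s\<close>: symmetrization cannot see that this root belongs to no solution.
  The hypothesis on the parameters says exactly that the second root coincides with this spurious one.\<close>
lemma no_bethe_solution:
  assumes cons: "k \<ge> 2" "m1 \<ge> 1"
    and cond: "(2 * int m1 + int m2)\<^sup>2 + int k * (4 * int m1 - (int m2)\<^sup>2) = 0"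
  shows "\<not> bethe_solution m1 m2 k t1 t2 s"
proof
  assume B: "bethe_solution m1 m2 k t1 t2 s"
  define m n \<kappa> :: complex where "m = of_nat m1" and "n = of_nat m2" and "\<kappa> = of_nat k"
  define N M c where "N = 2*m+n+2*\<kappa>" and "M = 2*m+n" and "c = m+\<kappa>-1"
  define a b where "a = t1+t2" and "b = t1*t2"
  have "of_int ((2 * int m1 + int m2)\<^sup>2 + int k * (4 * int m1 - (int m2)\<^sup>2)) = (0::complex)"
    using cond by simp
  hence cond': "M^2 + \<kappa> * (4*m - n^2) = 0" by (simp add: M_def m_def n_def \<kappa>_def)
  have "N = of_nat (2*m1+m2+2*k)" "c = of_nat (m1+k-1)" 
     "n + 2 = of_nat (m2+2)" "m+n+\<kappa> = of_nat (m1+m2+k)"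
    using cons by (simp_all add: N_def c_def m_def n_def \<kappa>_def of_nat_diff)
  hence nz: "N \<noteq> 0" "c \<noteq> 0" "n+2 \<noteq> 0" "m+n+\<kappa> \<noteq> 0"
    using cons by (simp_all only: of_nat_eq_0_iff)
  have "N * (1 - a + b) + \<kappa> * (a - 2) = 0" "c * a + (n+2)* s = M" "(n+2)* s^2 - (n+1)*a* s + n*b = 0"
    using symmetrized_bethe_system[of t1 t2 s m \<kappa> n] B
    unfolding bethe_solution_def N_def M_def c_def a_def b_def m_def n_def \<kappa>_def by blast+
  note eqs = this
  have d: "N * b = (N-\<kappa>) * a - M" using eqs(1) unfolding N_def M_def by (simp add: algebra_simps)
  have ca: "c * a = M - (n+2)* s" using eqs(2) by (simp add: eq_diff_eq)
  have "0 = c * (N * ((n+2)* s^2 - (n+1)*a* s + n*b))" using eqs by simp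
  also have "... = N*(n+2)*c* s^2 - N*(n+1)*(c*a)* s + c*n*(N*b)"
    by (simp add: algebra_simps)
  also have "... = N*(n+2)*c* s^2 - N*(n+1)*(c*a)* s + n*((N-\<kappa>)*(c*a) - M*c)"
    unfolding d by (simp add: algebra_simps)
  also have "... = (N* s - M) * ((n+2)*(m+n+\<kappa>)* s - n*(m+n+1))"
    unfolding ca unfolding N_def M_def c_def by (simp add: algebra_simps power2_eq_square)
  finally have "(N* s - M) * ((n+2)*(m+n+\<kappa>)* s - n*(m+n+1)) = 0" by simp
  moreover have "N* s - M = 0" if "(n+2)*(m+n+\<kappa>)* s - n*(m+n+1) = 0"
  proof -
    have "(n+2)*(m+n+\<kappa>)*(N* s-M) = N*((n+2)*(m+n+\<kappa>)* s - n*(m+n+1)) - (M^2 + \<kappa> * (4*m - n^2))"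
      unfolding N_def M_def by (simp add: algebra_simps power2_eq_square)
    thus ?thesis using nz that cond' by simp
  qed
  ultimately have sM: "N* s = M" by auto
  have "c * (N*a - 2*M) = N*(c*a) - 2*c*M" by (simp add: algebra_simps)
  also have "... = N*M - (n+2)*(N* s) - 2*c*M" unfolding ca by (simp add: algebra_simps)
  also have "... = 0" unfolding sM unfolding N_def c_def M_def by (simp add: algebra_simps)
  finally have a: "N*a = 2*M" using nz by simp
  have "N^2*(a^2 - 4*b) = (N*a)^2 - 4*N*(N*b)" by (simp add: algebra_simps power2_eq_square)
  also have "... = (N*a)^2 - 4*((N-\<kappa>)*(N*a) - N*M)" unfolding d by (simp add: algebra_simps)
  also have "... = 0" unfolding a unfolding N_def M_def by (simp add: algebra_simps power2_eq_square)
  finally have "a^2 - 4*b = 0" using nz by simp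
  hence "(t1-t2)^2 = 0" unfolding a_def b_def by (simp add: algebra_simps power2_eq_square)
  thus False using B by (simp add: bethe_solution_def)
qed

section \<open>Wronskians of polynomials and orders of vanishing\<close>

definition wronskian :: "'a::field_char_0 poly \<Rightarrow> 'a poly \<Rightarrow> 'a poly" where
  "wronskian f g = f * pderiv g - pderiv f * g"

lemma wronskian_diff_smult: "wronskian f (g - smult c f) = wronskian f g"
  by (simp add: wronskian_def pderiv_diff pderiv_smult algebra_simps)

lemma wronskian_self_smult: "wronskian f (smult c f) = 0"
  by (simp add: wronskian_def pderiv_smult algebra_simps)

lemma wronskian_smult_left: "wronskian (smult c f) g = smult c (wronskian f g)"
  by (simp add: wronskian_def pderiv_smult smult_diff_right)

lemma order_power_mult:
  fixes F :: "'a::idom poly"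
  assumes "poly F a \<noteq> 0"
  shows "order a ([:-a, 1:] ^ n * F) = n"
proof -
  have "[:-a, 1:] ^ n * F \<noteq> 0" using assms by auto
  thus ?thesis using assms by (subst order_mult) (auto simp: order_power_n_n order_0I)
qed

lemma linear_mult_pderiv_power:
  fixes a :: "'a::idom"
  shows "[:-a, 1:] * pderiv ([:-a, 1:] ^ n) = smult (of_nat n) ([:-a, 1:] ^ n)"
proof (cases n)
  case (Suc j)
  have "pderiv [:-a, 1:] = 1" by (simp add: pderiv_pCons)
  thus ?thesis unfolding Suc pderiv_power_Suc by (simp only: mult_smult_right mult_1_right power_Suc)
qed simp

text \<open>If \<open>f\<close> and \<open>g\<close> vanish to orders \<open>p\<close> and \<open>q\<close>, the lowest coefficient of the Wronskian is a
  multiple by \<open>q - p\<close> of the product of the two lowest coefficients.  No cancellation can occur when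
  \<open>p\<close> and \<open>q\<close> differ.\<close>
lemma order_wronskian:
  assumes f: "f \<noteq> 0" and g: "g \<noteq> 0" and ne: "order a f \<noteq> order a g"
  shows "wronskian f g \<noteq> 0" "order a (wronskian f g) = order a f + order a g - 1"
proof -
  define X where "X = [:-a, 1:]"
  define p q where "p = order a f" and "q = order a g"
  obtain F where F: "f = X ^ p * F" "poly F a \<noteq> 0"
    using order_decomp[OF f, of a] by (auto simp: X_def p_def dvd_iff_poly_eq_0)
  obtain G where G: "g = X ^ q * G" "poly G a \<noteq> 0"
    using order_decomp[OF g, of a] by (auto simp: X_def q_def dvd_iff_poly_eq_0)
  define R where "R = smult (of_nat q - of_nat p) (F * G) + X * wronskian F G"
  have dpow: "X * pderiv (X ^ n) = smult (of_nat n) (X ^ n)" for n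
    unfolding X_def by (rule linear_mult_pderiv_power)
  have "X * wronskian f g = (X^p * F) * (X * pderiv (X^q) * G + X^q * X * pderiv G) 
                 - (X * pderiv (X^p) * F + X^p * X * pderiv F) * (X^q * G)"
    by (simp add: F G wronskian_def pderiv_mult algebra_simps)
  also have "... = X ^ (p+q) * R"
    unfolding dpow by (simp add: R_def wronskian_def power_add algebra_simps smult_diff_left)
  finally have W: "X * wronskian f g = X ^ (p+q) * R" .
  have R0: "poly R a \<noteq> 0"
    using F G ne by (simp add: R_def X_def p_def q_def)
  hence nz: "R \<noteq> 0" by auto
  have X0: "X \<noteq> 0" by (simp add: X_def)
  show "wronskian f g \<noteq> 0" using W nz X0 by auto
  hence "order a (X * wronskian f g) = 1 + order a (wronskian f g)"
    using X0 order_power_n_n[of a 1] by (subst order_mult) (simp_all only: X_def power_one_right mult_eq_0_iff simp_thms)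
  moreover have "order a (X ^ (p+q) * R) = p + q"
    using R0 order_power_mult unfolding X_def by blast
  ultimately show "order a (wronskian f g) = order a f + order a g - 1"
    using W by (simp add: p_def q_def)
qed

text \<open>The Wronskian does not change when a multiple of \<open>f\<close> is subtracted from \<open>g\<close>, so the previous lemma
  applies to every pair with a non-zero Wronskian.\<close>
lemma make_orders_distinct:
  fixes f g :: "'a::field_char_0 poly"
  assumes f: "f \<noteq> 0" and W: "wronskian f g \<noteq> 0"
  obtains c where "g - smult c f \<noteq> 0" "order a (g - smult c f) \<noteq> order a f"
proof (cases "order a g = order a f")
  case False
  have "g \<noteq> 0" using W by (auto simp: wronskian_def)
  thus ?thesis using False that[of 0] by simp
next
  case True
  have g: "g \<noteq> 0" using W by (auto simp: wronskian_def)
  define p where "p = order a f"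
  obtain F where F: "f = [:-a, 1:] ^ p * F" "poly F a \<noteq> 0"
    using order_decomp[OF f, of a] by (auto simp: p_def dvd_iff_poly_eq_0)
  obtain G where G: "g = [:-a, 1:] ^ p * G" "poly G a \<noteq> 0"
    using order_decomp[OF g, of a] True by (auto simp: p_def dvd_iff_poly_eq_0)
  define c where "c = poly G a / poly F a"
  have h: "g - smult c f = [:-a, 1:] ^ p * (G - smult c F)"
    by (simp add: F G algebra_simps)
  have nz: "g - smult c f \<noteq> 0"
    using W wronskian_self_smult[of f c] by auto
  have "poly (G - smult c F) a = 0" using F by (simp add: c_def)
  hence "[:-a, 1:] dvd G - smult c F" by (simp only: poly_eq_0_iff_dvd)
  hence "[:-a, 1:] ^ Suc p dvd g - smult c f" 
    unfolding h power_Suc2 by (rule mult_dvd_mono[OF dvd_refl])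
  hence "Suc p \<le> order a (g - smult c f)" using nz order_divides by blast
  thus ?thesis using that[of c] nz by (simp add: p_def)
qed

lemma order_wronskian_in_space:
  assumes V: "module.subspace smult V" and fg: "f \<in> V" "g \<in> V" and W: "wronskian f g \<noteq> 0"
  obtains q where "q \<in> order a ` (V - {0})" "q \<noteq> order a f" 
     "order a (wronskian f g) = order a f + q - 1"
proof -
  interpret vector_space "smult :: 'a \<Rightarrow> 'a poly \<Rightarrow> 'a poly" 
    by unfold_locales (simp_all add: smult_add_right smult_add_left)
  have f: "f \<noteq> 0" using W by (auto simp: wronskian_def)
  obtain c where c: "g - smult c f \<noteq> 0" "order a (g - smult c f) \<noteq> order a f"
    using make_orders_distinct[OF f W] .
  have "g - smult c f \<in> V" using V fg by (intro subspace_diff subspace_scale) auto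
  thus ?thesis
    using that[of "order a (g - smult c f)"] c order_wronskian(2)[OF f c(1), of a]
      wronskian_diff_smult[of f g c] by auto
qed

lemma degree_wronskian_le: "degree (wronskian f g) \<le> degree f + degree g - 1"
proof -
  have "degree (f * pderiv g) \<le> degree f + degree g - 1"
  proof (cases "pderiv g = 0")
    case False
    hence "degree g \<noteq> 0" by (simp add: pderiv_eq_0_iff)
    thus ?thesis using degree_mult_le[of f "pderiv g"] by (simp add: degree_pderiv)
  qed simp
  moreover have "degree (pderiv f * g) \<le> degree f + degree g - 1"
  proof (cases "pderiv f = 0")
    case False
    hence "degree f \<noteq> 0" by (simp add: pderiv_eq_0_iff)
    thus ?thesis using degree_mult_le[of "pderiv f" g] by (simp add: degree_pderiv)
  qed simp
  ultimately show ?thesis unfolding wronskian_def by (intro degree_diff_le)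
qed

lemma coeff_wronskian_top:
  assumes "degree f > 0" "degree g > 0"
  shows "coeff (wronskian f g) (degree f + degree g - 1) = 
     (of_nat (degree g) - of_nat (degree f)) * lead_coeff f * lead_coeff g"
proof -
  have "coeff (f * pderiv g) (degree f + degree g - 1) = lead_coeff f * (of_nat (degree g) * lead_coeff g)"
    using coeff_mult_degree_sum[of f "pderiv g"] assms by (simp add: degree_pderiv coeff_pderiv)
  moreover have "coeff (pderiv f * g) (degree f + degree g - 1) = (of_nat (degree f) * lead_coeff f) * lead_coeff g"
    using coeff_mult_degree_sum[of "pderiv f" g] assms by (simp add: degree_pderiv coeff_pderiv)
  ultimately show ?thesis by (simp add: wronskian_def algebra_simps)
qed

text \<open>The Wronskian of the two Wronskians is \<open>f\<close> times the three-fold Wronskian of \<open>f\<close>, \<open>g\<close>, \<open>h\<close>.\<close>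
lemma dvd_wronskian_wronskian: "f dvd wronskian (wronskian f g) (wronskian f h)"
proof -
  have "wronskian (wronskian f g) (wronskian f h) = f * 
    (f * (pderiv g * pderiv (pderiv h) - pderiv (pderiv g) * pderiv h)
     - pderiv f * (g * pderiv (pderiv h) - pderiv (pderiv g) * h)
     + pderiv (pderiv f) * (g * pderiv h - pderiv g * h))"
    unfolding wronskian_def by (simp add: pderiv_mult pderiv_diff algebra_simps)
  thus ?thesis by simp
qed

lemma wronskian_mult_left: "wronskian (h * f) (h * g) = h\<^sup>2 * wronskian f g"
  by (simp add: wronskian_def pderiv_mult algebra_simps power2_eq_square)

lemma prime_powers_dvd_of_orders:
  fixes p :: "'a::idom poly"
  assumes p: "p \<noteq> 0" and ab: "a \<noteq> b" and m: "m \<le> order a p" and n: "n \<le> order b p"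
  shows "[:-a, 1:] ^ m * [:-b, 1:] ^ n dvd p"
proof -
  obtain r where r: "p = [:-a, 1:] ^ m * r"
    using m p by (metis order_divides dvdE)
  have "order b ([:-a, 1:] ^ m) = 0" using ab by (intro order_0I) simp
  hence "n \<le> order b r" using n p unfolding r by (simp add: order_mult)
  hence "[:-b, 1:] ^ n dvd r" by (simp add: order_divides)
  thus ?thesis unfolding r by (rule mult_dvd_mono[OF dvd_refl])
qed

lemma dvd_cancel_linear_power:
  fixes F :: "'a::idom poly"
  assumes F: "poly F a \<noteq> 0" and dvd: "F dvd [:-a, 1:] ^ n * R"
  shows "F dvd R"
  using dvd
proof (induction n)
  case (Suc n)
  obtain G where G: "[:-a, 1:] * ([:-a, 1:] ^ n * R) = F * G"
    using Suc.prems by (auto simp only: power_Suc mult.assoc elim: dvdE)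
  have "poly F a * poly G a = 0" unfolding poly_mult[symmetric] G[symmetric] by simp
  hence "[:-a, 1:] dvd G" using F by (simp only: poly_eq_0_iff_dvd[symmetric] mult_eq_0_iff) simp
  then obtain H where H: "G = [:-a, 1:] * H" by auto
  have "[:-a, 1:] * ([:-a, 1:] ^ n * R) = [:-a, 1:] * (F * H)"
    unfolding G H by (simp only: mult.left_commute)
  hence "[:-a, 1:] ^ n * R = F * H" by (subst (asm) mult_left_cancel) auto
  thus ?case using Suc.IH by simp
qed simp

section \<open>The space V and its polynomials\<close>

text \<open>The part of a Wronskian of two elements of \<open>V\<close> that is forced by the orders of vanishing at
  0 and 1; dividing it out of the Wronskian of \<open>f0\<close> and \<open>f1\<close> produces \<open>y2\<close>.\<close>
definition vanishing_factor :: "nat \<Rightarrow> nat \<Rightarrow> complex poly" where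
  "vanishing_factor m k = [:0, 1:] ^ m * [:-1, 1:] ^ k"

lemma V_space_orders:
  assumes "is_V_space m1 m2 2 1 k V" "f \<in> V" "f \<noteq> 0"
  shows "order 0 f \<in> {0, m1+1, m1+m2+2}" "order 1 f \<in> {0, k+1, k+2}"
proof -
  have f: "f \<in> V - {0}" using assms by simp
  show "order 0 f \<in> {0, m1+1, m1+m2+2}" "order 1 f \<in> {0, k+1, k+2}"
    using imageI[OF f, of "order 0"] imageI[OF f, of "order 1"] assms(1)
    by (simp_all only: is_V_space_def)
qed

text \<open>Two distinct orders of vanishing at 0 have sum at least \<open>m1 + 1\<close>, and two distinct orders at 1 have
  sum at least \<open>k + 1\<close>.\<close>
lemma vanishing_factor_dvd_wronskian:
  assumes V: "is_V_space m1 m2 2 1 k V" and f: "f \<in> V" and g: "g \<in> V"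
  shows "vanishing_factor m1 k dvd wronskian f g"
proof (cases "wronskian f g = 0")
  case False
  have sub: "module.subspace smult V" using V by (simp add: is_V_space_def)
  have f0: "f \<noteq> 0" using False by (auto simp: wronskian_def)
  have o: "order 0 f \<in> {0, m1+1, m1+m2+2}" "order 1 f \<in> {0, k+1, k+2}"
    using V_space_orders[OF V f f0] .
  obtain p where p: "p \<in> order 0 ` (V - {0})" "p \<noteq> order 0 f" "order 0 (wronskian f g) = order 0 f + p - 1"
    by (rule order_wronskian_in_space[OF sub f g False])
  have "p \<in> {0, m1+1, m1+m2+2}" using V p(1) by (simp only: is_V_space_def)
  hence 0: "m1 \<le> order 0 (wronskian f g)" using p o by auto
  obtain q where q: "q \<in> order 1 ` (V - {0})" "q \<noteq> order 1 f" "order 1 (wronskian f g) = order 1 f + q - 1"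
    by (rule order_wronskian_in_space[OF sub f g False])
  have "q \<in> {0, k+1, k+2}" using V q(1) by (simp only: is_V_space_def)
  hence 1: "k \<le> order 1 (wronskian f g)" using q o by auto
  show ?thesis using prime_powers_dvd_of_orders[OF False _ 0 1] by (simp add: vanishing_factor_def)
qed simp

lemma order_vanishing_factor: "order 0 (vanishing_factor m k * R) = m + order 0 R" if "R \<noteq> 0" for R
proof -
  have "poly ([:-1, 1:] ^ k) 0 \<noteq> (0::complex)" by simp
  hence "order 0 (vanishing_factor m k) = m"
    using order_power_mult[of "[:-1, 1:] ^ k" 0 m] by (simp add: vanishing_factor_def)
  moreover have "vanishing_factor m k * R \<noteq> 0" using that by (simp add: vanishing_factor_def)
  ultimately show ?thesis by (simp add: order_mult)
qed

lemma degree_vanishing_factor: "degree (vanishing_factor m k) = m + k"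
  and lead_coeff_vanishing_factor: "lead_coeff (vanishing_factor m k) = 1"
  and vanishing_factor_nz: "vanishing_factor m k \<noteq> 0"
proof -
  show "vanishing_factor m k \<noteq> 0" by (simp add: vanishing_factor_def)
  show "degree (vanishing_factor m k) = m + k" by (simp add: vanishing_factor_def degree_mult_eq degree_power_eq)
  show "lead_coeff (vanishing_factor m k) = 1" unfolding vanishing_factor_def lead_coeff_mult lead_coeff_power by simp
qed

text \<open>After division by the forced factor, the degree leaves room for one linear factor only.  Its root \<open>s\<close>
  is not 0, since no sum of two distinct orders at 0 equals \<open>m1 + 2\<close>.\<close>
lemma wronskian_of_monic_pair:
  assumes V: "is_V_space m1 m2 2 1 k V" and cons: "m1 \<ge> 1" "m2 \<ge> 1" "k \<ge> 2"
    and f0: "f0 \<in> V" "lead_coeff f0 = 1" "degree f0 = 2"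
    and f1: "f1 \<in> V" "lead_coeff f1 = 1" "degree f1 = m1 + k"
  obtains s where "s \<noteq> 0"
    "wronskian f0 f1 = smult (of_nat (m1 + k) - 2) (vanishing_factor m1 k * [:-s, 1:])"
proof -
  define \<delta> :: complex where "\<delta> = of_nat (m1 + k) - of_nat 2"
  have "of_nat (m1 + k) \<noteq> (of_nat 2 :: complex)" using cons by (subst of_nat_eq_iff) simp
  hence \<delta>: "\<delta> \<noteq> 0" by (simp add: \<delta>_def)
  let ?W = "wronskian f0 f1"
  have top: "coeff ?W (m1 + k + 1) = \<delta>"
    using coeff_wronskian_top[of f0 f1] f0 f1 cons by (simp add: \<delta>_def)
  hence W: "?W \<noteq> 0" using \<delta> by auto
  have deg: "degree ?W = m1 + k + 1"
    using degree_wronskian_le[of f0 f1] f0 f1 top \<delta> by (intro antisym le_degree) auto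
  obtain l where l: "?W = vanishing_factor m1 k * l"
    using vanishing_factor_dvd_wronskian[OF V f0(1) f1(1)] by auto
  have l0: "l \<noteq> 0" using W l by auto
  have dl: "degree l = 1" using deg l0 vanishing_factor_nz by (simp add: l degree_mult_eq degree_vanishing_factor)
  have "lead_coeff l = \<delta>" using top deg unfolding l by (metis lead_coeff_mult lead_coeff_vanishing_factor mult_1)
  hence "l = [:coeff l 0, \<delta>:]" using dl by (intro poly_eqI) (auto simp: coeff_pCons coeff_eq_0 split: nat.splits)
  define s where "s = - coeff l 0 / \<delta>"
  have ls: "l = smult \<delta> [:-s, 1:]" using \<open>l = [:coeff l 0, \<delta>:]\<close> \<delta> by (simp add: s_def)
  have "s \<noteq> 0"
  proof
    assume "s = 0"
    hence "order 0 l = order 0 ([:-0, 1:] ^ 1 :: complex poly)" using \<delta> unfolding ls by (subst order_smult) simp_all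
    hence "order 0 l = 1" by (simp only: order_power_n_n)
    hence ord: "order 0 ?W = m1 + 1" using order_vanishing_factor[OF l0] l by simp
    obtain p where p: "p \<in> order 0 ` (V - {0})" "p \<noteq> order 0 f0" "order 0 ?W = order 0 f0 + p - 1"
      by (rule order_wronskian_in_space[OF _ f0(1) f1(1) W]) (use V in \<open>simp add: is_V_space_def\<close>)
    have "p \<in> {0, m1+1, m1+m2+2}" using V p(1) by (simp only: is_V_space_def)
    moreover have "order 0 f0 \<in> {0, m1+1, m1+m2+2}" 
      using f0 by (intro V_space_orders(1)[OF V]) auto
    ultimately show False using p ord cons by auto
  qed
  moreover have "?W = smult \<delta> (vanishing_factor m1 k * [:-s, 1:])"
    unfolding l ls by (rule mult_smult_right)
  ultimately show ?thesis using that[of s] unfolding \<delta>_def of_nat_numeral by blast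
qed

text \<open>The third element of the flag is taken to be some \<open>g\<close> in \<open>V\<close> with the largest order at 0.  Write
  \<open>Q\<close> for the cofactor of its Wronskian with \<open>f0\<close>.  The Wronskian \<open>Z\<close> of \<open>x - s\<close> and \<open>Q\<close> is divisible by
  \<open>x ^ m2 * f0\<close>, and by degrees it is a constant multiple of it.  As the derivative of \<open>(x - s) * Q' - Q\<close> is
  \<open>(x - s) * Q''\<close>, the derivative of \<open>x ^ m2 * f0\<close> vanishes at \<open>s\<close>; this is the equation for \<open>s\<close>
  in the system, without denominators.\<close>
lemma bethe_equation_second_root:
  assumes V: "is_V_space m1 m2 2 1 k V" and cons: "m1 \<ge> 1" "m2 \<ge> 1" "k \<ge> 2"
    and f0: "f0 \<in> V" "lead_coeff f0 = 1" "degree f0 = 2"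
    and s: "s \<noteq> 0" and \<delta>: "\<delta> \<noteq> 0"
    and W1: "wronskian f0 f1 = smult \<delta> (vanishing_factor m1 k * [:-s, 1:])"
  shows "of_nat m2 * poly f0 s + s * poly (pderiv f0) s = 0"
proof -
  have f0nz: "f0 \<noteq> 0" using f0 by auto
  define p where "p = order 0 f0"
  have "p \<le> 2" using order_degree[OF f0nz, of 0] f0 by (simp add: p_def)
  have "m1 + m2 + 2 \<in> order 0 ` (V - {0})" using V by (simp only: is_V_space_def) simp
  then obtain g where "m1 + m2 + 2 = order 0 g" "g \<in> V - {0}" by (rule imageE)
  hence g: "g \<in> V" "g \<noteq> 0" "order 0 g = m1 + m2 + 2" by simp_all
  have ne: "order 0 f0 \<noteq> order 0 g" using g \<open>p \<le> 2\<close> cons by (simp add: p_def)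
  note Wg = order_wronskian[OF f0nz g(2) ne]
  obtain Q where Q: "wronskian f0 g = vanishing_factor m1 k * Q"
    using vanishing_factor_dvd_wronskian[OF V f0(1) g(1)] by auto
  have Qnz: "Q \<noteq> 0" using Wg Q by auto
  have ordQ: "order 0 Q = p + m2 + 1"
    using Wg(2) order_vanishing_factor[OF Qnz, of m1 k] g(3) unfolding Q p_def by simp
  have "degree g \<in> degree ` (V - {0})" using g by auto
  hence dg: "degree g \<le> m1 + m2 + k + 1" using V cons
    by (auto simp only: is_V_space_def exp0_def exp1_def exp2_def)
  have "m1 + k + degree Q = degree (wronskian f0 g)"
    unfolding Q using Qnz vanishing_factor_nz by (simp add: degree_mult_eq degree_vanishing_factor)
  also have "... \<le> m1 + m2 + k + 2" using degree_wronskian_le[of f0 g] f0 dg by simp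
  finally have dQ: "degree Q \<le> m2 + 2" by simp
  define L where "L = [:-s, 1:]"
  define Z where "Z = wronskian L Q"
  have L: "L \<noteq> 0" "order 0 L = 0" using s by (auto simp: L_def intro: order_0I)
  have Z: "Z \<noteq> 0" "order 0 Z = p + m2"
    using order_wronskian[OF L(1) Qnz, of 0] L ordQ by (simp_all add: Z_def)
  have dZ: "degree Z \<le> m2 + 2" using degree_wronskian_le[of L Q] dQ by (simp add: Z_def L_def)
  have "f0 dvd wronskian (wronskian f0 f1) (wronskian f0 g)" by (rule dvd_wronskian_wronskian)
  also have "wronskian (wronskian f0 f1) (wronskian f0 g) = smult \<delta> ((vanishing_factor m1 k)\<^sup>2 * Z)"
    unfolding W1 Q Z_def L_def wronskian_smult_left wronskian_mult_left ..
  finally have dvd: "f0 dvd (vanishing_factor m1 k)\<^sup>2 * Z" using \<delta> by (simp add: dvd_smult_iff)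
  \<comment> \<open>The power of \<open>x\<close> in \<open>f0\<close> is split off because \<open>m1 = 1\<close> and \<open>f0 = x^2\<close> has not been excluded yet.\<close>
  obtain F where F: "f0 = [:-0, 1:] ^ p * F" "poly F 0 \<noteq> 0"
    using order_decomp[OF f0nz, of 0] by (auto simp: p_def dvd_iff_poly_eq_0)
  obtain Z' where Z': "Z = [:-0, 1:] ^ (p + m2) * Z'"
    using Z order_divides[of 0 "p + m2" Z] by (auto elim: dvdE)
  have "poly f0 1 \<noteq> 0"
  proof
    assume "poly f0 1 = 0"
    hence "order 1 f0 \<noteq> 0" using f0nz order_root by blast
    hence "order 1 f0 > 2" using V_space_orders(2)[OF V f0(1) f0nz] cons by auto
    thus False using order_degree[OF f0nz, of 1] f0 by simp
  qed
  hence F1: "poly F 1 \<noteq> 0" using F by auto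
  have sq: "(vanishing_factor m1 k)\<^sup>2 = [:-0, 1:] ^ (m1 * 2) * [:-1, 1:] ^ (k * 2)"
    unfolding vanishing_factor_def power_mult_distrib power_mult by (simp only: minus_zero)
  have "F dvd f0" by (subst F(1)) (rule dvd_triv_right)
  hence "F dvd (vanishing_factor m1 k)\<^sup>2 * Z" using dvd by (rule dvd_trans)
  hence "F dvd [:-0, 1:] ^ (m1 * 2) * ([:-1, 1:] ^ (k * 2) * ([:-0, 1:] ^ (p + m2) * Z'))"
    by (simp only: sq Z' mult.assoc)
  hence "F dvd Z'"
    by (rule dvd_cancel_linear_power[OF F(2) dvd_cancel_linear_power[OF F1 dvd_cancel_linear_power[OF F(2)]]])
  then obtain c where c: "Z' = F * c" by auto
  have Zc: "Z = [:0, 1:] ^ m2 * f0 * c" unfolding Z' c F(1) by (simp add: power_add mult_ac del: mult_pCons_left mult_pCons_right)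
  have cnz: "c \<noteq> 0" using Z Zc by auto
  have "degree Z = m2 + 2 + degree c" unfolding Zc using cnz f0nz f0
    by (simp add: degree_mult_eq degree_power_eq)
  hence "degree c = 0" using dZ by simp
  then obtain d where d: "c = [:d:]" by (rule degree_eq_zeroE)
  have dnz: "d \<noteq> 0" using cnz d by auto
  have "pderiv Z = L * pderiv (pderiv Q)"
    by (simp add: Z_def wronskian_def pderiv_mult L_def pderiv_pCons pderiv_diff pderiv_smult)
  hence "poly (pderiv Z) s = 0" by (simp add: L_def)
  moreover have "s * poly (pderiv ([:0, 1:] ^ m2)) s = of_nat m2 * s ^ m2"
    using arg_cong[OF linear_mult_pderiv_power[of 0 m2], of "\<lambda>p. poly p s"] by simp
  hence "d * ((s * poly (pderiv ([:0, 1:] ^ m2)) s) * poly f0 s + s ^ m2 * (s * poly (pderiv f0) s)) =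
     d * s ^ m2 * (of_nat m2 * poly f0 s + s * poly (pderiv f0) s)"
    by (simp add: algebra_simps)
  hence "s * poly (pderiv Z) s = d * s ^ m2 * (of_nat m2 * poly f0 s + s * poly (pderiv f0) s)"
    unfolding Zc d by (simp add: pderiv_mult pderiv_smult algebra_simps)
  ultimately show ?thesis using dnz s by simp
qed

lemma monic_quadratic_splits:
  fixes f :: "complex poly"
  assumes "degree f = 2" "lead_coeff f = 1"
  obtains t1 t2 where "f = [:-t1, 1:] * [:-t2, 1:]"
proof -
  obtain t1 where "poly f t1 = 0"
    using fundamental_theorem_of_algebra_alt[of f] assms by (metis alg_closed_imp_poly_has_root less_numeral_extra(3) pos2)
  then obtain g where g: "f = [:-t1, 1:] * g" by (auto simp only: poly_eq_0_iff_dvd elim: dvdE)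
  have "g \<noteq> 0" using assms g by auto
  hence "degree g = 1" using assms unfolding g by (subst (asm) degree_mult_eq) auto
  moreover have "lead_coeff g = 1" using assms(2) unfolding g lead_coeff_mult by simp
  ultimately have "g = [:-(- coeff g 0), 1:]" 
    by (intro poly_eqI) (auto simp: coeff_pCons coeff_eq_0 split: nat.splits)
  thus ?thesis using that g by metis
qed

text \<open>At a root of \<open>f\<close> the Wronskian and its derivative reduce to \<open>- f' g\<close> and \<open>- f'' g\<close>, so \<open>g\<close> can be
  eliminated.\<close>
lemma wronskian_at_root:
  assumes "poly f t = 0"
  shows "poly (pderiv f) t * poly (pderiv (wronskian f g)) t = poly (pderiv (pderiv f)) t * poly (wronskian f g) t"
  using assms by (simp add: wronskian_def pderiv_mult pderiv_diff)

lemma log_deriv_vanishing_factor: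
  assumes t: "t \<noteq> 0" "t \<noteq> 1"
  shows "poly (pderiv (vanishing_factor m k * [:-s, 1:])) t =
     poly (vanishing_factor m k) t * ((of_nat m / t + of_nat k / (t - 1)) * (t - s) + 1)"
proof -
  have p: "poly (pderiv ([:-a, 1:] ^ n)) t = of_nat n / (t - a) * (t - a) ^ n" if "t \<noteq> a" for n and a :: complex
  proof -
    have "(t - a) * poly (pderiv ([:-a, 1:] ^ n)) t = of_nat n * (t - a) ^ n"
      using arg_cong[OF linear_mult_pderiv_power[of a n], of "\<lambda>p. poly p t"]
      by (simp add: left_diff_distrib)
    thus ?thesis using that by (simp add: field_simps)
  qed
  have "poly (pderiv ([:0, 1:] ^ m)) t = of_nat m / t * t ^ m"
    "poly (pderiv ([:-1, 1:] ^ k)) t = of_nat k / (t - 1) * (t - 1) ^ k"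
    using p[of 0 m] p[of 1 k] t by simp_all
  moreover have "pderiv [:-s, 1:] = 1" by (simp add: pderiv_pCons)
  ultimately show ?thesis
    unfolding vanishing_factor_def pderiv_mult poly_add poly_mult poly_power by (simp add: algebra_simps)
qed

text \<open>At a simple root \<open>t\<close> of \<open>f\<close>, the ratio \<open>f'' / f'\<close> equals \<open>2 / (t - t')\<close> and also the logarithmic
  derivative of the Wronskian, whose factors are known.\<close>
lemma bethe_equation_first_root:
  assumes f: "f = [:-t, 1:] * [:-t', 1:]" and tt': "t \<noteq> t'" and t: "t \<noteq> 0" "t \<noteq> 1" and \<delta>: "\<delta> \<noteq> 0"
    and W: "wronskian f g = smult \<delta> (vanishing_factor m k * [:-s, 1:])"
  shows "t \<noteq> s" "of_nat m / t + of_nat k / (t - 1) - 2 / (t - t') + 1 / (t - s) = 0"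
proof -
  define T where "T = poly (vanishing_factor m k) t"
  have T: "T \<noteq> 0" using t by (simp add: T_def vanishing_factor_def)
  define A where "A = of_nat m / t + of_nat k / (t - 1)"
  have "poly f t = 0" "poly (pderiv f) t = t - t'" "poly (pderiv (pderiv f)) t = 2"
    unfolding f by (simp_all add: pderiv_mult pderiv_pCons pderiv_add)
  moreover have "poly (vanishing_factor m k * [:-s, 1:]) t = T * (t - s)"
    unfolding poly_mult T_def by simp
  ultimately have "(t - t') * (\<delta> * (T * (A * (t - s) + 1))) = 2 * (\<delta> * (T * (t - s)))"
    using wronskian_at_root[of f t g] log_deriv_vanishing_factor[OF t, of m k s]
    unfolding W pderiv_smult poly_smult A_def[symmetric] T_def[symmetric] by (simp only:)
  hence "\<delta> * T * ((t - t') * (A * (t - s) + 1)) = \<delta> * T * (2 * (t - s))"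
    by (simp only: mult_ac)
  hence eq: "(t - t') * (A * (t - s) + 1) = 2 * (t - s)" using \<delta> T by simp
  thus ts: "t \<noteq> s" using tt' by auto
  show "of_nat m / t + of_nat k / (t - 1) - 2 / (t - t') + 1 / (t - s) = 0"
    using eq ts tt' unfolding A_def[symmetric] by (simp add: divide_simps) (simp add: algebra_simps)
qed

text \<open>If the roots of \<open>f0\<close> were distinct, they would form with \<open>s\<close> a solution of the Bethe equations.
  Hence \<open>f0\<close> has a double root, which is a root of the Wronskian other than 0 and 1, that is, \<open>s\<close>.\<close>
lemma f0_eq_y2_square:
  assumes cons: "m1 \<ge> 1" "m2 \<ge> 1" "k \<ge> 2"
    and cond: "(2 * int m1 + int m2)\<^sup>2 + int k * (4 * int m1 - (int m2)\<^sup>2) = 0"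
    and V: "is_V_space m1 m2 2 1 k V"
    and f0: "f0 \<in> V" "lead_coeff f0 = 1" "degree f0 = 2"
    and f1: "f1 \<in> V" "lead_coeff f1 = 1" "degree f1 = m1 + k"
  shows "f0 = (y2_poly m1 m2 2 1 k f0 f1)\<^sup>2"
proof -
  define \<delta> :: complex where "\<delta> = of_nat (m1 + k) - 2"
  have "of_nat (m1 + k) \<noteq> (of_nat 2 :: complex)" using cons by (subst of_nat_eq_iff) simp
  hence \<delta>: "\<delta> \<noteq> 0" by (simp add: \<delta>_def)
  obtain s where s: "s \<noteq> 0" and W: "wronskian f0 f1 = smult \<delta> (vanishing_factor m1 k * [:-s, 1:])"
    using wronskian_of_monic_pair[OF V cons f0 f1] unfolding \<delta>_def by blast
  have "exp1 m1 m2 2 1 k = m1 + k" "exp0 m1 m2 2 1 k = 2" by (simp_all add: exp1_def exp0_def)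
  hence "y2_poly m1 m2 2 1 k f0 f1 = wronskian f0 f1 div smult \<delta> (vanishing_factor m1 k)"
    unfolding y2_poly_def wronskian_def \<delta>_def vanishing_factor_def by simp
  also have "... = [:-s, 1:]"
    unfolding W mult_smult_left[symmetric] using \<delta> vanishing_factor_nz by (intro nonzero_mult_div_cancel_left) simp
  finally have y2: "y2_poly m1 m2 2 1 k f0 f1 = [:-s, 1:]" .
  obtain t1 t2 where t: "f0 = [:-t1, 1:] * [:-t2, 1:]"
    using monic_quadratic_splits f0 by blast
  have f0nz: "f0 \<noteq> 0" using f0 by auto
  have sec: "of_nat m2 * poly f0 s + s * poly (pderiv f0) s = 0"
    by (rule bethe_equation_second_root[OF V cons f0 s \<delta> W])
  \<comment> \<open>If \<open>f0\<close> vanished at 0, it would be \<open>x^2\<close>, and the equation for \<open>s\<close> would give \<open>s = 0\<close>.\<close>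
  have at0: "poly f0 0 \<noteq> 0"
  proof
    assume "poly f0 0 = 0"
    hence "order 0 f0 \<noteq> 0" using f0nz order_root by blast
    hence "2 \<le> order 0 f0" using V_space_orders(1)[OF V f0(1) f0nz] cons by auto
    hence "[:-0, 1:] ^ 2 dvd f0" using order_divides by blast
    then obtain c where c: "f0 = [:-0, 1:] ^ 2 * c" by auto
    have "c \<noteq> 0" using c f0nz by auto
    hence "degree c = 0" using f0(3) unfolding c by (simp add: degree_mult_eq degree_power_eq)
    then obtain d where d: "c = [:d:]" by (rule degree_eq_zeroE)
    have "d \<noteq> 0" using \<open>c \<noteq> 0\<close> d by simp
    have "of_nat m2 * poly f0 s + s * poly (pderiv f0) s = d * s ^ 2 * of_nat (m2 + 2)"
      unfolding c d by (simp add: pderiv_mult pderiv_pCons pderiv_power power2_eq_square algebra_simps)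
    moreover have "of_nat (m2 + 2) \<noteq> (0::complex)" by (simp only: of_nat_eq_0_iff)
    ultimately show False using sec s \<open>d \<noteq> 0\<close> by simp
  qed
  have at1: "poly f0 1 \<noteq> 0"
  proof
    assume "poly f0 1 = 0"
    hence "order 1 f0 \<noteq> 0" using f0nz order_root by blast
    hence "order 1 f0 > 2" using V_space_orders(2)[OF V f0(1) f0nz] cons by auto
    thus False using order_degree[OF f0nz, of 1] f0 by simp
  qed
  have tn: "t1 \<noteq> 0" "t2 \<noteq> 0" "t1 \<noteq> 1" "t2 \<noteq> 1" using at0 at1 unfolding t by auto
  have "t1 = t2"
  proof (rule ccontr)
    assume ne: "t1 \<noteq> t2"
    have t': "f0 = [:-t2, 1:] * [:-t1, 1:]" unfolding t by (rule mult.commute)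
    note b1 = bethe_equation_first_root[OF t ne tn(1,3) \<delta> W]
    note b2 = bethe_equation_first_root[OF t' ne[symmetric] tn(2,4) \<delta> W]
    have "of_nat m2 * ((s - t1) * (s - t2)) + s * ((s - t1) + (s - t2)) = 0"
      using sec unfolding t by (simp add: pderiv_mult pderiv_pCons algebra_simps)
    hence "of_nat m2 / s + 1 / (s - t1) + 1 / (s - t2) = 0"
      using b1(1) b2(1) s by (simp add: divide_simps) (simp add: algebra_simps)
    hence "bethe_solution m1 m2 k t1 t2 s"
      using b1 b2 tn ne s by (simp add: bethe_solution_def)
    thus False using no_bethe_solution cons cond by blast
  qed
  have "poly f0 t1 = 0" "poly (pderiv f0) t1 = 0" "poly (pderiv (pderiv f0)) t1 = 2"
    unfolding t \<open>t1 = t2\<close> by (simp_all add: pderiv_mult pderiv_pCons pderiv_add)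
  hence "poly (wronskian f0 f1) t1 = 0" using wronskian_at_root[of f0 t1 f1] by simp
  hence "t1 = s" unfolding W using \<delta> tn by (simp add: vanishing_factor_def)
  thus ?thesis unfolding y2 using t \<open>t1 = t2\<close> by (simp only: power2_eq_square)
qed

section \<open>Representations of sl3\<close>

unbundle no Formal_Power_Series.fps_syntax

lemma matrix_diff_ldistrib: "A ** (B - C) = A ** B - A ** C" for A :: "complex^'n^'m"
  by (simp add: matrix_matrix_mult_def vec_eq_iff right_diff_distrib sum_subtractf)

lemma matrix_diff_rdistrib: "(A - B) ** C = A ** C - B ** C" for A :: "complex^'n^'m"
  by (simp add: matrix_matrix_mult_def vec_eq_iff left_diff_distrib sum_subtractf)

lemma matrix_minus_mult: "(- A) ** C = - (A ** C)" "A ** (- C) = - (A ** C)" for A :: "complex^'n^'m"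
  by (simp_all add: matrix_matrix_mult_def vec_eq_iff sum_negf)

lemma unit_matrix_mult: "unit_matrix p q ** unit_matrix r s = (if q = r then unit_matrix p s else 0)"
proof -
  have "(\<Sum>k\<in>UNIV. unit_matrix p q $ i $ k * unit_matrix r s $ k $ j) 
     = (if q = r then unit_matrix p s else 0) $ i $ j" for i j
    by (subst sum.remove[of _ q]) (auto simp: unit_matrix_def intro!: sum.neutral)
  thus ?thesis by (simp add: vec_eq_iff matrix_matrix_mult_def)
qed

lemma two_distinct: "(1::2) \<noteq> 2" "(2::2) \<noteq> 1"
  by simp_all

lemma trace_3: "trace (A :: complex^3^3) = A$1$1 + A$2$2 + A$3$3"
  by (simp add: trace_def sum_3)

lemma chevalley_in_sl3: "chevalley_E i \<in> sl3" "chevalley_F i \<in> sl3" "chevalley_H i \<in> sl3"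
  by (simp_all add: sl3_def trace_3 chevalley_E_def chevalley_F_def chevalley_H_def unit_matrix_mult)
     (simp_all add: unit_matrix_def)

lemma mat_mult_left_nth: "(mat c ** A) $ i $ j = c * A $ i $ j" for A :: "complex^'n^'m"
  by (simp add: matrix_matrix_mult_def mat_def if_distrib[of "\<lambda>x. x * _"] sum.delta cong: if_cong)

lemma sl3_closed:
  "X \<in> sl3 \<Longrightarrow> Y \<in> sl3 \<Longrightarrow> X + Y \<in> sl3" "X \<in> sl3 \<Longrightarrow> mat c ** X \<in> sl3"
  "X ** Y - Y ** X \<in> sl3"
proof -
  show "X \<in> sl3 \<Longrightarrow> Y \<in> sl3 \<Longrightarrow> X + Y \<in> sl3" by (simp add: sl3_def trace_add)
  show "X \<in> sl3 \<Longrightarrow> mat c ** X \<in> sl3"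
    by (simp add: sl3_def trace_3 mat_mult_left_nth flip: distrib_left)
  show "X ** Y - Y ** X \<in> sl3" by (simp add: sl3_def trace_sub trace_mul_sym[of X Y])
qed

lemma bracket_EF:
  "chevalley_E i ** chevalley_F j - chevalley_F j ** chevalley_E i = (if i = j then chevalley_H i else 0)"
  using exhaust_2[of i] exhaust_2[of j]
  by (auto simp: chevalley_H_def chevalley_E_def chevalley_F_def unit_matrix_mult)

lemma bracket_HE:
  "chevalley_H i ** chevalley_E j - chevalley_E j ** chevalley_H i 
     = mat (of_int (simple_root i $ j)) ** chevalley_E j"
  using exhaust_2[of i] exhaust_2[of j]
  by (auto simp: chevalley_H_def chevalley_E_def chevalley_F_def unit_matrix_mult matrix_diff_ldistrib
     matrix_diff_rdistrib vec_eq_iff mat_mult_left_nth simple_root_def)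

lemma bracket_HF:
  "chevalley_H i ** chevalley_F j - chevalley_F j ** chevalley_H i 
     = mat (- of_int (simple_root i $ j)) ** chevalley_F j"
  using exhaust_2[of i] exhaust_2[of j]
  by (auto simp: chevalley_H_def chevalley_E_def chevalley_F_def unit_matrix_mult matrix_diff_ldistrib
     matrix_diff_rdistrib vec_eq_iff mat_mult_left_nth simple_root_def)

lemma serre:
  "chevalley_F 1 ** (chevalley_F 1 ** chevalley_F 2 - chevalley_F 2 ** chevalley_F 1) - 
   (chevalley_F 1 ** chevalley_F 2 - chevalley_F 2 ** chevalley_F 1) ** chevalley_F 1 = 0"
  by (simp add: chevalley_F_def unit_matrix_mult matrix_minus_mult matrix_diff_ldistrib matrix_diff_rdistrib)

lemma n_plus_decomp:
  assumes "X \<in> n_plus"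
  shows "X = mat (X$1$2) ** chevalley_E 1 + (mat (X$2$3) ** chevalley_E 2 
     + mat (X$1$3) ** (chevalley_E 1 ** chevalley_E 2 - chevalley_E 2 ** chevalley_E 1))"
proof -
  have *: "X $ i $ j \<noteq> 0 \<longrightarrow> (i, j) \<in> {(1, 2), (1, 3), (2, 3)}" for i j
    using assms unfolding n_plus_def by blast
  have "X$1$1 = 0" "X$2$1 = 0" "X$2$2 = 0" "X$3$1 = 0" "X$3$2 = 0" "X$3$3 = 0"
    using * [of 1 1] *[of 2 1] *[of 2 2] *[of 3 1] *[of 3 2] *[of 3 3] by simp_all
  thus ?thesis unfolding vec_eq_iff forall_3
    by (simp add: chevalley_E_def unit_matrix_mult mat_mult_left_nth) (simp add: unit_matrix_def)
qed

text \<open>The coefficient of \<open>H 2\<close> is the sum of the first two diagonal entries, hence minus the third.\<close>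
lemma sl3_decomp:
  assumes "X \<in> sl3"
  shows "X = mat (X$1$2) ** chevalley_E 1 + (mat (X$2$3) ** chevalley_E 2 
     + (mat (X$1$3) ** (chevalley_E 1 ** chevalley_E 2 - chevalley_E 2 ** chevalley_E 1)
     + (mat (X$2$1) ** chevalley_F 1 + (mat (X$3$2) ** chevalley_F 2 
     + (mat (X$3$1) ** (chevalley_F 2 ** chevalley_F 1 - chevalley_F 1 ** chevalley_F 2)
     + (mat (X$1$1) ** chevalley_H 1 + mat (- X$3$3) ** chevalley_H 2))))))"
proof -
  have "X$1$1 + X$2$2 + X$3$3 = 0" using assms by (simp add: sl3_def trace_3)
  hence "X$2$2 = - X$1$1 - X$3$3" by algebra
  thus ?thesis unfolding vec_eq_iff forall_3
    by (simp add: chevalley_E_def chevalley_F_def chevalley_H_def unit_matrix_mult mat_mult_left_nth) 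
       (simp add: unit_matrix_def)
qed

lemma chevalley_E_n_plus: "chevalley_E i \<in> n_plus"
  by (auto simp: n_plus_def chevalley_E_def unit_matrix_def split: if_splits)

lemmas mv_linear = matrix_vector_right_distrib vector_scalar_commute matrix_vector_mult_diff_distrib
  matrix_vector_mult_0_right

lemma mat_mult_vec: "(mat c ** A) *v u = c *s (A *v u)" for A :: "complex^'n^'m"
  by (simp add: vec_eq_iff matrix_vector_mult_def mat_mult_left_nth sum_distrib_left mult.assoc)

lemma mat_vec_span:
  fixes A :: "complex^'n^'n"
  assumes "\<And>b. b \<in> B \<Longrightarrow> A *v b \<in> vec.span S" "x \<in> vec.span B"
  shows "A *v x \<in> vec.span S"
  using assms(2)
proof (induction rule: vec.span_induct_alt)
  case base thus ?case by (simp add: vec.span_zero)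
next
  case (step c x y) thus ?case using assms(1)
    by (simp add: mv_linear vec.span_add vec.span_scale)
qed

locale sl3_module =
  fixes \<rho> :: "complex^3^3 \<Rightarrow> complex^'n^'n"
  assumes rep: "sl3_rep \<rho>"
begin

abbreviation "E i u \<equiv> \<rho> (chevalley_E i) *v u"
abbreviation "F i u \<equiv> \<rho> (chevalley_F i) *v u"
abbreviation "H i u \<equiv> \<rho> (chevalley_H i) *v u"

lemma rep_add: "X \<in> sl3 \<Longrightarrow> Y \<in> sl3 \<Longrightarrow> \<rho> (X + Y) *v u = \<rho> X *v u + \<rho> Y *v u"
  using rep by (simp add: sl3_rep_def matrix_vector_mult_add_rdistrib)

lemma rep_scale: "X \<in> sl3 \<Longrightarrow> \<rho> (mat c ** X) *v u = c *s (\<rho> X *v u)"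
  using rep by (simp add: sl3_rep_def mat_mult_vec)

lemma rep_bracket: "X \<in> sl3 \<Longrightarrow> Y \<in> sl3 \<Longrightarrow> \<rho> (X ** Y - Y ** X) *v u = \<rho> X *v (\<rho> Y *v u) - \<rho> Y *v (\<rho> X *v u)"
  using rep by (simp add: sl3_rep_def matrix_vector_mult_diff_rdistrib matrix_vector_mul_assoc)

lemma rep_zero: "\<rho> 0 *v u = 0"
proof -
  have "mat 0 ** chevalley_E 1 = (0 :: complex^3^3)" by (simp add: vec_eq_iff mat_mult_left_nth)
  thus ?thesis using rep_scale[OF chevalley_in_sl3(1), of 0 1 u] by simp
qed

lemma E_F: "E i (F j u) = F j (E i u) + (if i = j then H i u else 0)"
  using rep_bracket[OF chevalley_in_sl3(1,2), of i j u] unfolding bracket_EF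
  by (auto simp: rep_zero algebra_simps split: if_splits)

lemma H_E: "H i (E j u) = E j (H i u) + of_int (simple_root i $ j) *s E j u"
  using rep_bracket[OF chevalley_in_sl3(3,1), of i j u] unfolding bracket_HE
  by (simp add: rep_scale chevalley_in_sl3 algebra_simps)

lemma H_F: "H i (F j u) = F j (H i u) - of_int (simple_root i $ j) *s F j u"
  using rep_bracket[OF chevalley_in_sl3(3,2), of i j u] unfolding bracket_HF
  by (simp add: rep_scale chevalley_in_sl3 algebra_simps)

text \<open>The Serre relation, in the form that moves \<open>F 2\<close> away from the left end.\<close>
lemma serre_F: "F 2 (F 1 (F 1 u)) = 2 *s F 1 (F 2 (F 1 u)) - F 1 (F 1 (F 2 u))"
proof -
  have "0 = F 1 (F 1 (F 2 u) - F 2 (F 1 u)) - (F 1 (F 2 (F 1 u)) - F 2 (F 1 (F 1 u)))"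
    using rep_bracket[OF chevalley_in_sl3(2)[of 1] sl3_closed(3)[of "chevalley_F 1" "chevalley_F 2"], of u]
    unfolding serre by (simp add: rep_zero rep_bracket chevalley_in_sl3)
  thus ?thesis by (simp add: mv_linear vec_eq_iff algebra_simps)
qed

lemma invariant_subspace:
  assumes W: "vec.subspace W" and E: "\<And>i u. u \<in> W \<Longrightarrow> E i u \<in> W" and F: "\<And>i u. u \<in> W \<Longrightarrow> F i u \<in> W"
    and X: "X \<in> sl3" and u: "u \<in> W"
  shows "\<rho> X *v u \<in> W"
proof -
  have H: "H i u \<in> W" for i
  proof -
    have "H i u = E i (F i u) - F i (E i u)" by (simp add: E_F)
    thus ?thesis using u E F by (simp add: vec.subspace_diff[OF W])
  qed
  have "\<rho> X *v u = (X$1$2) *s E 1 u + (X$2$3 *s E 2 u + (X$1$3 *s (E 1 (E 2 u) - E 2 (E 1 u))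
     + (X$2$1 *s F 1 u + (X$3$2 *s F 2 u + (X$3$1 *s (F 2 (F 1 u) - F 1 (F 2 u)) 
     + (X$1$1 *s H 1 u + (- X$3$3) *s H 2 u))))))"
    by (subst sl3_decomp[OF X]) (simp only: rep_add rep_scale rep_bracket sl3_closed chevalley_in_sl3)
  also have "... \<in> W" using E F H u
    by (intro vec.subspace_add[OF W] vec.subspace_scale[OF W] vec.subspace_diff[OF W]) auto
  finally show ?thesis .
qed

lemma n_plus_kills:
  assumes "E 1 u = 0" "E 2 u = 0" "X \<in> n_plus"
  shows "\<rho> X *v u = 0"
  by (subst n_plus_decomp[OF assms(3)])
     (simp add: rep_add rep_scale rep_bracket sl3_closed chevalley_in_sl3 assms mv_linear)

lemma weight_space_F:
  assumes "u \<in> weight_space \<rho> \<mu>"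
  shows "F j u \<in> weight_space \<rho> (\<mu> - simple_root j)"
proof -
  have "simple_root i $ j = simple_root j $ i" for i by (simp add: simple_root_def)
  thus ?thesis using assms unfolding weight_space_def
    by (simp add: H_F mv_linear vec.scale_left_diff_distrib)
qed

lemma weight_space_unique:
  assumes "u \<in> weight_space \<rho> \<mu>" "u \<in> weight_space \<rho> \<nu>" "u \<noteq> 0"
  shows "\<mu> = \<nu>"
proof -
  have "of_int (\<mu> $ i) *s u = of_int (\<nu> $ i) *s u" for i using assms by (simp add: weight_space_def)
  hence "of_int (\<mu> $ i) = (of_int (\<nu> $ i) :: complex)" for i 
    using assms(3) vec.scale_right_imp_eq by blast
  thus ?thesis by (simp add: vec_eq_iff)
qed

lemma subspace_weight_space: "vec.subspace (weight_space \<rho> \<mu>)"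
  by (auto simp: vec.subspace_def weight_space_def mv_linear vec_eq_iff algebra_simps)

text \<open>Weight vectors of different weights are independent.  In the induction step a vector \<open>b\<close> of weight
  \<open>\<nu> \<noteq> \<mu>\<close> is removed by applying \<open>H i - \<nu> i\<close>, where \<open>i\<close> is a coordinate in which the weights differ;
  this operator multiplies the whole sum by a non-zero scalar.  The summand \<open>d\<close> collects the vectors of weight
  \<open>\<mu>\<close> met so far.\<close>
lemma weight_vector_in_span_aux:
  assumes "finite T" "d \<in> D" and D: "vec.subspace D" "D \<subseteq> weight_space \<rho> \<mu>"
    and T: "\<And>b. b \<in> T \<Longrightarrow> b \<in> D \<or> (\<exists>\<nu>. \<nu> \<noteq> \<mu> \<and> b \<in> weight_space \<rho> \<nu>)"
    and x: "d + (\<Sum>b\<in>T. c b *s b) \<in> weight_space \<rho> \<mu>"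
  shows "d + (\<Sum>b\<in>T. c b *s b) \<in> D"
  using assms(1,2) T x
proof (induction T arbitrary: d c rule: finite_induct)
  case empty thus ?case by simp
next
  case (insert b T)
  let ?x = "d + (\<Sum>b\<in>insert b T. c b *s b)"
  show ?case
  proof (cases "b \<in> D")
    case True
    hence "d + c b *s b \<in> D" using insert.prems(1) D by (intro vec.subspace_add vec.subspace_scale)
    thus ?thesis using insert.IH[of "d + c b *s b" c] insert.prems insert.hyps by (simp add: add.assoc)
  next
    case False
    then obtain \<nu> where \<nu>: "\<nu> \<noteq> \<mu>" "b \<in> weight_space \<rho> \<nu>" using insert.prems(2) by blast
    then obtain i where i: "\<nu> $ i \<noteq> \<mu> $ i" by (auto simp: vec_eq_iff)
    define s :: complex where "s = of_int (\<mu> $ i) - of_int (\<nu> $ i)"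
    have s: "s \<noteq> 0" using i by (simp add: s_def)
    have "\<exists>e. \<forall>b\<in>T. H i b = e b *s b"
    proof (intro exI ballI)
      fix b' assume b': "b' \<in> T"
      hence "\<exists>\<nu>. b' \<in> weight_space \<rho> \<nu>" using insert.prems(2) D(2) by blast
      hence "\<exists>e. H i b' = e *s b'" by (auto simp: weight_space_def)
      thus "H i b' = (SOME e. H i b' = e *s b') *s b'" by (rule someI_ex)
    qed
    then obtain e where e: "\<And>b. b \<in> T \<Longrightarrow> H i b = e b *s b" by blast
    have Hd: "H i d = of_int (\<mu> $ i) *s d" using insert.prems(1) D(2) by (auto simp: weight_space_def)
    have Hb: "H i b = of_int (\<nu> $ i) *s b" using \<nu> by (simp add: weight_space_def)
    have "s *s ?x = H i ?x - of_int (\<nu> $ i) *s ?x"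
      using insert.prems(3) by (simp add: weight_space_def s_def vec.scale_left_diff_distrib)
    also have "H i ?x = of_int (\<mu> $ i) *s d + (c b * of_int (\<nu> $ i)) *s b + (\<Sum>b\<in>T. (c b * e b) *s b)"
      using insert.hyps e by (simp add: mv_linear Hd Hb linear_sum[OF matrix_vector_mul_linear] add.assoc)
    also have "... - of_int (\<nu> $ i) *s ?x = s *s d + (\<Sum>b\<in>T. (c b * (e b - of_int (\<nu> $ i))) *s b)"
      using insert.hyps by (simp add: s_def vec.scale_right_distrib vec.scale_sum_right vec.scale_left_diff_distrib
        right_diff_distrib sum_subtractf algebra_simps)
    finally have eq: "s *s ?x = s *s d + (\<Sum>b\<in>T. (c b * (e b - of_int (\<nu> $ i))) *s b)" .
    have "s *s ?x \<in> weight_space \<rho> \<mu>"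
      using insert.prems(3) by (intro vec.subspace_scale subspace_weight_space)
    hence "s *s ?x \<in> D" unfolding eq
      using insert.prems D by (intro insert.IH vec.subspace_scale) auto
    hence "inverse s *s (s *s ?x) \<in> D" by (rule vec.subspace_scale[OF D(1)])
    thus ?thesis using left_inverse[OF s] by (simp only: vector_smult_assoc vector_smult_lid)
  qed
qed

lemma weight_vector_in_span:
  assumes B: "\<And>b. b \<in> B \<Longrightarrow> \<exists>\<nu>. b \<in> weight_space \<rho> \<nu>"
    and x: "x \<in> vec.span B" "x \<in> weight_space \<rho> \<mu>"
  shows "x \<in> vec.span (B \<inter> weight_space \<rho> \<mu>)"
proof -
  let ?D = "vec.span (B \<inter> weight_space \<rho> \<mu>)"
  obtain T c where T: "finite T" "T \<subseteq> B" "x = (\<Sum>b\<in>T. c b *s b)"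
    using x(1) unfolding vec.span_explicit by blast
  have D: "?D \<subseteq> weight_space \<rho> \<mu>" by (intro vec.span_minimal subspace_weight_space) auto
  have "b \<in> ?D \<or> (\<exists>\<nu>. \<nu> \<noteq> \<mu> \<and> b \<in> weight_space \<rho> \<nu>)" if "b \<in> T" for b
  proof (cases "b \<in> weight_space \<rho> \<mu>")
    case True
    thus ?thesis using that T(2) by (auto intro: vec.span_base)
  next
    case False
    have "\<exists>\<nu>. b \<in> weight_space \<rho> \<nu>" using B that T(2) by blast
    thus ?thesis using False by metis
  qed
  thus ?thesis
    using weight_vector_in_span_aux[OF T(1) vec.span_zero vec.subspace_span D, of c] x(2) T(3) by simp
qed

text \<open>An \<open>E\<close>-word shifts all weights by the same amount, so it commutes with \<open>H i\<close> up to a multiple of itself.\<close>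
lemma H_E_word:
  "\<exists>c. H i (foldr E as u) = foldr E as (H i u) + c *s foldr E as u"
proof (induction as)
  case Nil
  have "H i u = H i u + 0 *s u" by simp
  thus ?case by auto
next
  case (Cons a as)
  then obtain c where c: "H i (foldr E as u) = foldr E as (H i u) + c *s foldr E as u" by blast
  have "H i (E a (foldr E as u)) = E a (foldr E as (H i u)) + (c + of_int (simple_root i $ a)) *s E a (foldr E as u)"
    by (simp add: H_E c mv_linear vec.scale_left_distrib add.assoc)
  thus ?case by (intro exI[of _ "c + of_int (simple_root i $ a)"]) simp
qed

lemma E_word_linear:
  "foldr E as (x + y) = foldr E as x + foldr E as y" "foldr E as (c *s x) = c *s foldr E as x"
  "foldr E as 0 = 0"
  by (induction as) (simp_all add: mv_linear)

end

lemma simple_root_sum: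
  "sum_list (map simple_root as) = 
     of_nat (count_list as 1) *s simple_root 1 + of_nat (count_list as 2) *s simple_root 2"
proof (induction as)
  case (Cons a as)
  thus ?case using exhaust_2[of a] by (auto simp: vec_eq_iff algebra_simps)
qed (simp add: vec_eq_iff)

lemma simple_root_nth: "simple_root 1 $ 1 = 2" "simple_root 1 $ 2 = -1" "simple_root 2 $ 1 = -1" "simple_root 2 $ 2 = 2"
  by (simp_all add: simple_root_def)

lemma simple_root_sum_eqD:
  assumes "sum_list (map simple_root as) = of_nat p *s simple_root 1 + of_nat q *s simple_root 2"
  shows "count_list as 1 = p" "count_list as 2 = q"
proof -
  have "(of_nat (count_list as 1) *s simple_root 1 + of_nat (count_list as 2) *s simple_root 2) $ i =
    (of_nat p *s simple_root 1 + of_nat q *s simple_root 2 :: int^2) $ i" for i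
    using assms unfolding simple_root_sum by simp
  from this[of 1] this[of 2] show "count_list as 1 = p" "count_list as 2 = q"
    by (simp_all add: simple_root_nth)
qed

lemma length_two_letters: "length as = count_list as 1 + count_list as 2" for as :: "2 list"
proof (induction as)
  case (Cons a as)
  thus ?case using exhaust_2[of a] by auto
qed simp

locale highest_weight_module =
  fixes \<rho> :: "complex^3^3 \<Rightarrow> complex^'n^'n" and v :: "complex^'n" and \<Lambda> :: "int^2"
  assumes is_L: "is_L \<Lambda> \<rho> v"
begin

sublocale sl3_module \<rho>
  using is_L by unfold_locales (simp add: is_L_def irreducible_rep_def)

lemma v_nz: "v \<noteq> 0"
  using is_L by (simp add: is_L_def)

lemma v_weight: "v \<in> weight_space \<rho> \<Lambda>"
  using is_L by (simp add: is_L_def Sing_def)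

lemma H_v: "H i v = of_int (\<Lambda> $ i) *s v"
  using v_weight by (simp add: weight_space_def)

lemma E_v: "E i v = 0"
  using is_L chevalley_E_n_plus by (auto simp: is_L_def Sing_def)

lemma irreducible:
  assumes "vec.subspace W" "\<And>i u. u \<in> W \<Longrightarrow> E i u \<in> W" "\<And>i u. u \<in> W \<Longrightarrow> F i u \<in> W"
  shows "W = {0} \<or> W = UNIV"
proof -
  have "\<forall>X\<in>sl3. \<forall>w\<in>W. \<rho> X *v w \<in> W" using invariant_subspace assms by blast
  thus ?thesis using is_L assms(1) by (simp add: is_L_def irreducible_rep_def)
qed

abbreviation "word as \<equiv> foldr F as v"

lemma word_weight: "word as \<in> weight_space \<rho> (\<Lambda> - sum_list (map simple_root as))"
proof (induction as)
  case Nil thus ?case using v_weight by simp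
next
  case (Cons a as)
  show ?case using weight_space_F[OF Cons.IH, of a] by (simp add: algebra_simps)
qed

text \<open>The span of the \<open>F\<close>-words is a non-zero submodule: an \<open>E\<close> can be commuted to the right until it
  kills \<open>v\<close>.\<close>
lemma words_span: "vec.span (range word) = UNIV"
proof -
  let ?S = "vec.span (range word)"
  have F: "F i u \<in> ?S" if "u \<in> ?S" for i u
  proof (rule mat_vec_span[OF _ that])
    fix b assume "b \<in> range word"
    then obtain as where "b = word as" by blast
    hence "F i b = word (i # as)" by simp
    thus "F i b \<in> ?S" by (metis rangeI vec.span_base)
  qed
  have Ew: "E i (word as) \<in> ?S" for i as
  proof (induction as)
    case Nil thus ?case by (simp add: E_v vec.span_zero)
  next
    case (Cons a as)
    have "H i (word as) = of_int ((\<Lambda> - sum_list (map simple_root as)) $ i) *s word as"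
      using word_weight[of as] unfolding weight_space_def by blast
    moreover have "word as \<in> ?S" by (simp add: vec.span_base)
    ultimately have "H i (word as) \<in> ?S" by (simp only: vec.span_scale)
    thus ?case using F[OF Cons.IH, of a] by (auto simp: E_F intro: vec.span_add)
  qed
  have "E i u \<in> ?S" if "u \<in> ?S" for i u
    by (rule mat_vec_span[OF _ that]) (use Ew in blast)
  hence "?S = {0} \<or> ?S = UNIV" using F by (intro irreducible vec.subspace_span)
  moreover have "word [] \<in> ?S" by (rule vec.span_base[OF rangeI])
  ultimately show ?thesis using v_nz by auto
qed

lemma weight_vector_word:
  assumes x: "x \<in> weight_space \<rho> \<mu>" "x \<in> vec.span (word ` A)"
  shows "x \<in> vec.span (word ` {as \<in> A. \<Lambda> - sum_list (map simple_root as) = \<mu>})"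
proof -
  let ?W = "word ` {as \<in> A. \<Lambda> - sum_list (map simple_root as) = \<mu>}"
  have "x \<in> vec.span (word ` A \<inter> weight_space \<rho> \<mu>)"
    using x word_weight by (intro weight_vector_in_span) auto
  also have "... \<subseteq> vec.span ?W"
  proof (intro vec.span_minimal vec.subspace_span subsetI)
    fix b assume "b \<in> word ` A \<inter> weight_space \<rho> \<mu>"
    then obtain as where as: "as \<in> A" "b = word as" "word as \<in> weight_space \<rho> \<mu>" by blast
    show "b \<in> vec.span ?W"
    proof (cases "b = 0")
      case True thus ?thesis by (simp add: vec.span_zero)
    next
      case False
      hence "\<Lambda> - sum_list (map simple_root as) = \<mu>"
        using weight_space_unique word_weight as by metis
      thus ?thesis using as by (intro vec.span_base) blast
    qed
  qed
  finally show ?thesis .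
qed

lemma v_notin_lower: "v \<notin> vec.span (word ` {as. as \<noteq> []})"
proof
  assume "v \<in> vec.span (word ` {as. as \<noteq> []})"
  hence "v \<in> vec.span (word ` {as \<in> {as. as \<noteq> []}. \<Lambda> - sum_list (map simple_root as) = \<Lambda>})"
    by (rule weight_vector_word[OF v_weight])
  moreover have empty: "{as \<in> {as. as \<noteq> []}. \<Lambda> - sum_list (map simple_root as) = \<Lambda>} = {}"
  proof -
    have "as = []" if "\<Lambda> - sum_list (map simple_root as) = \<Lambda>" for as
    proof -
      have "sum_list (map simple_root as) = of_nat 0 *s simple_root 1 + of_nat 0 *s simple_root 2"
        using that by (simp add: vec_eq_iff)
      from simple_root_sum_eqD[OF this] have "length as = 0" by (simp only: length_two_letters)
      thus ?thesis by simp
    qed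
    thus ?thesis by blast
  qed
  ultimately show False unfolding empty using v_nz by simp
qed

text \<open>Three words have this weight.  One of them vanishes because it starts with \<open>F 2 v\<close>, and the Serre relation
  makes the other two proportional.\<close>
lemma weight_vector_depth_21:
  assumes "F 2 v = 0" "x \<in> weight_space \<rho> (\<Lambda> - 2 *s simple_root 1 - simple_root 2)"
  shows "\<exists>c. x = c *s F 1 (F 2 (F 1 v))"
proof -
  let ?z = "F 1 (F 2 (F 1 v))"
  have "x \<in> vec.span (word ` {as \<in> UNIV. \<Lambda> - sum_list (map simple_root as) = \<Lambda> - 2 *s simple_root 1 - simple_root 2})"
    using words_span assms(2) by (intro weight_vector_word) simp_all
  also have "... \<subseteq> vec.span {?z}"
  proof (intro vec.span_minimal vec.subspace_span subsetI)
    fix b assume "b \<in> word ` {as \<in> UNIV. \<Lambda> - sum_list (map simple_root as) = \<Lambda> - 2 *s simple_root 1 - simple_root 2}"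
    then obtain as where as: "b = word as" "\<Lambda> - sum_list (map simple_root as) = \<Lambda> - 2 *s simple_root 1 - simple_root 2"
      by blast
    have "sum_list (map simple_root as) = of_nat 2 *s simple_root 1 + of_nat 1 *s simple_root 2"
      using as(2) by (simp add: algebra_simps)
    note c = simple_root_sum_eqD[OF this]
    have "length as = 3" using c by (simp only: length_two_letters)
    then obtain i j l where ijl: "as = [i, j, l]" by (auto simp: length_Suc_conv numeral_3_eq_3)
    have "as = [1,1,2] \<or> as = [1,2,1] \<or> as = [2,1,1]"
      using c exhaust_2[of i] exhaust_2[of j] exhaust_2[of l] unfolding ijl by auto
    hence "b = 0 \<or> b = ?z \<or> b = 2 *s ?z" using assms(1) by (auto simp: as(1) serre_F mv_linear)
    thus "b \<in> vec.span {?z}"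
      by (metis vec.span_base vec.span_scale vec.span_zero singletonI)
  qed
  finally show ?thesis by (auto simp: vec.span_singleton)
qed

text \<open>The coordinate of \<open>v\<close> in the weight decomposition: in the dual module it is the vector of lowest weight.\<close>
definition leading_functional :: "(complex^'n \<Rightarrow> complex) \<Rightarrow> bool" where
  "leading_functional \<phi> \<longleftrightarrow> (\<forall>x y. \<phi> (x + y) = \<phi> x + \<phi> y) \<and> (\<forall>c x. \<phi> (c *s x) = c * \<phi> x) \<and>
     \<phi> v = 1 \<and> (\<forall>i u. \<phi> (F i u) = 0) \<and> (\<forall>i u. \<phi> (H i u) = of_int (\<Lambda> $ i) * \<phi> u)"

lemma leading_functionalD:
  assumes "leading_functional \<phi>"
  shows "\<phi> (x + y) = \<phi> x + \<phi> y" "\<phi> (c *s x) = c * \<phi> x" "\<phi> 0 = 0" "\<phi> v = 1" "\<phi> (F i u) = 0"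
    "\<phi> (H i u) = of_int (\<Lambda> $ i) * \<phi> u"
proof -
  have "\<phi> (0 *s 0) = 0 * \<phi> 0" using assms unfolding leading_functional_def by blast
  thus "\<phi> 0 = 0" by simp
qed (use assms in \<open>simp_all add: leading_functional_def\<close>)

lemma ex_leading_functional: "\<exists>\<phi>. leading_functional \<phi>"
proof -
  let ?S = "vec.span (word ` {as. as \<noteq> []})"
  obtain B where B: "B \<subseteq> ?S" "vec.independent B" "?S \<subseteq> vec.span B" and "card B = vec.dim ?S"
    by (rule vec.basis_exists)
  have "vec.span B = ?S" using B vec.span_minimal[OF B(1) vec.subspace_span] by blast
  hence "v \<notin> vec.span B" using v_notin_lower by simp
  hence ind: "vec.independent (insert v B)" and "v \<notin> B" using B(2) vec.independent_insertI vec.span_base by blast+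
  obtain g :: "complex^'n \<Rightarrow> complex^'n" where g: "Vector_Spaces.linear (*s) (*s) g" 
      "\<And>x. x \<in> insert v B \<Longrightarrow> g x = (if x = v then v else 0)"
    using vec.linear_independent_extend[OF ind, of "\<lambda>x. if x = v then v else 0"] by blast
  interpret g: Vector_Spaces.linear "(*s)" "(*s)" g by (rule g(1))
  have gS: "g x = 0" if "x \<in> ?S" for x
  proof -
    have "x \<in> vec.span B" using that B(3) by blast
    thus ?thesis using g.eq_0_on_span[of B x] g(2) \<open>v \<notin> B\<close> by fastforce
  qed
  obtain j where j: "v $ j \<noteq> 0" using v_nz by (auto simp: vec_eq_iff)
  define \<phi> where "\<phi> x = g x $ j / v $ j" for x
  have add: "\<phi> (x + y) = \<phi> x + \<phi> y" for x y by (simp add: \<phi>_def g.add add_divide_distrib)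
  have scale: "\<phi> (c *s x) = c * \<phi> x" for c x by (simp add: \<phi>_def g.scale)
  have S: "\<phi> x = 0" if "x \<in> ?S" for x using gS[OF that] by (simp add: \<phi>_def)
  have v: "\<phi> v = 1" using g(2)[of v] j by (simp add: \<phi>_def)
  have FS: "F i u \<in> ?S" for i u
  proof -
    have "u \<in> vec.span (range word)" using words_span by simp
    thus ?thesis
    proof (rule mat_vec_span[rotated])
      fix b assume "b \<in> range word"
      then obtain as where "b = word as" by blast
      hence "F i b = word (i # as)" by simp
      thus "F i b \<in> ?S" by (intro vec.span_base) blast
    qed
  qed
  have "\<phi> (H i u) = of_int (\<Lambda> $ i) * \<phi> u" for i u
  proof -
    have "u \<in> vec.span (range word)" using words_span by simp
    thus ?thesis
    proof (induction rule: vec.span_induct_alt)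
      case base 
      have "\<phi> 0 = 0" using scale[of 0 0] by simp
      thus ?case by simp
    next
      case (step c x y)
      then obtain as where as: "x = word as" by blast
      have "\<phi> (H i x) = of_int (\<Lambda> $ i) * \<phi> x"
      proof (cases "as = []")
        case True thus ?thesis by (simp add: as H_v scale)
      next
        case False
        hence x0: "\<phi> x = 0" unfolding as by (intro S vec.span_base) blast
        have "H i x = of_int ((\<Lambda> - sum_list (map simple_root as)) $ i) *s x"
          using word_weight[of as] unfolding weight_space_def as by blast
        thus ?thesis using x0 by (simp only: scale mult_zero_right)
      qed
      thus ?case using step by (simp add: mv_linear add scale algebra_simps)
    qed
  qed
  hence "leading_functional \<phi>" using add scale v S[OF FS] by (simp add: leading_functional_def)
  thus ?thesis by blast
qed

text \<open>The vectors \<open>y\<close> with this property form a submodule, by commuting \<open>F\<close> to the left until it is killed by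
  \<open>\<phi>\<close>.  This submodule does not contain \<open>v\<close>.  Equivalently, the raising operators generate the dual module
  from \<open>\<phi>\<close>.\<close>
lemma zero_if_E_words_vanish:
  assumes \<phi>: "leading_functional \<phi>"
    and y: "\<And>as. \<phi> (foldr E as y) = 0"
  shows "y = 0"
proof -
  note add = leading_functionalD(1)[OF \<phi>] and scale = leading_functionalD(2)[OF \<phi>] and zero = leading_functionalD(3)[OF \<phi>]
    and v = leading_functionalD(4)[OF \<phi>] and F = leading_functionalD(5)[OF \<phi>] and H = leading_functionalD(6)[OF \<phi>]
  define A where "A = {y. \<forall>as. \<phi> (foldr E as y) = 0}"
  have sub: "vec.subspace A"
    by (auto simp: vec.subspace_def A_def E_word_linear add scale zero)
  have EA: "E i u \<in> A" if "u \<in> A" for i u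
  proof -
    have "\<phi> (foldr E as (E i u)) = 0" for as
    proof -
      have "\<phi> (foldr E (as @ [i]) u) = 0" using that unfolding A_def by blast
      thus ?thesis by simp
    qed
    thus ?thesis by (simp add: A_def)
  qed
  have HA: "\<phi> (foldr E as (H i u)) = 0" if "u \<in> A" for i u as
  proof -
    obtain c where "H i (foldr E as u) = foldr E as (H i u) + c *s foldr E as u" using H_E_word by blast
    hence "\<phi> (H i (foldr E as u)) = \<phi> (foldr E as (H i u)) + c * \<phi> (foldr E as u)" by (simp add: add scale)
    thus ?thesis using that by (simp add: H A_def)
  qed
  have FA: "F i u \<in> A" if "u \<in> A" for i u
  proof -
    have "\<phi> (foldr E as (F i u)) = 0" for as
      using that
    proof (induction as arbitrary: u rule: rev_induct)
      case Nil thus ?case by (simp add: F)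
    next
      case (snoc a as)
      thus ?case using EA HA by (simp add: E_F E_word_linear add zero)
    qed
    thus ?thesis by (simp add: A_def)
  qed
  have "v \<notin> A"
  proof
    assume "v \<in> A"
    hence "\<phi> (foldr E [] v) = 0" unfolding A_def by blast
    thus False using v by simp
  qed
  hence "A = {0}" using irreducible[OF sub EA FA] by auto
  thus ?thesis using y unfolding A_def by blast
qed

text \<open>All \<open>E j\<close> kill \<open>F i v\<close> when \<open>\<Lambda>\<close> vanishes on the coroot, so every \<open>E\<close>-word takes it into the kernel
  of the leading functional.\<close>
lemma F_v_zero:
  assumes "\<Lambda> $ i = 0"
  shows "F i v = 0"
proof -
  obtain \<phi> where \<phi>: "leading_functional \<phi>" using ex_leading_functional by blast
  have E0: "E j (F i v) = 0" for j using assms by (auto simp: E_F E_v H_v mv_linear)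
  have "\<phi> (foldr E as (F i v)) = 0" for as
    by (cases as rule: rev_cases) (simp_all add: leading_functionalD[OF \<phi>] E0 E_word_linear)
  thus ?thesis by (intro zero_if_E_words_vanish[OF \<phi>])
qed

end

section \<open>Tensor products\<close>

lemma tensor_rep_apply:
  "(tensor_rep \<rho>1 \<rho>2 X *v u) $ (a, b) = 
     (\<rho>1 X *v (\<chi> i. u $ (i, b))) $ a + (\<rho>2 X *v (\<chi> j. u $ (a, j))) $ b"
  for u :: "complex^('n::finite \<times> 'm::finite)"
proof -
  have "(tensor_rep \<rho>1 \<rho>2 X *v u) $ (a, b) = 
    (\<Sum>i\<in>UNIV. \<Sum>j\<in>UNIV. \<rho>1 X $ a $ i * (if b = j then 1 else 0) * u $ (i, j)
       + (if a = i then 1 else 0) * \<rho>2 X $ b $ j * u $ (i, j))"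
    by (simp add: matrix_vector_mult_def tensor_rep_def sum.cartesian_product distrib_right 
        case_prod_unfold flip: UNIV_Times_UNIV)
  also have "... = (\<Sum>i\<in>UNIV. \<Sum>j\<in>UNIV. if b = j then \<rho>1 X $ a $ i * u $ (i, j) else 0)
     + (\<Sum>i\<in>UNIV. if a = i then \<Sum>j\<in>UNIV. \<rho>2 X $ b $ j * u $ (i, j) else 0)"
    unfolding sum.distrib by (intro arg_cong2[of _ _ _ _ "(+)"] sum.cong refl) auto
  also have "... = (\<Sum>i\<in>UNIV. \<rho>1 X $ a $ i * u $ (i, b)) + (\<Sum>j\<in>UNIV. \<rho>2 X $ b $ j * u $ (a, j))"
    by simp
  finally show ?thesis by (simp add: matrix_vector_mult_def)
qed

lemma tensor_rep_tensor_vec: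
  "tensor_rep \<rho>1 \<rho>2 X *v tensor_vec a b = tensor_vec (\<rho>1 X *v a) b + tensor_vec a (\<rho>2 X *v b)"
proof -
  have 1: "(A *v (\<chi> i. a $ i * c)) $ n = (A *v a) $ n * c" for A :: "complex^'k^'l" and a c n
    by (simp add: matrix_vector_mult_def sum_distrib_right mult.assoc)
  have 2: "(A *v (\<chi> i. c * a $ i)) $ n = c * (A *v a) $ n" for A :: "complex^'k^'l" and a c n
    by (simp add: matrix_vector_mult_def sum_distrib_left mult.left_commute)
  show ?thesis
    by (simp add: vec_eq_iff tensor_rep_apply 1 2 tensor_vec_def split_paired_all)
qed

lemma sl3_rep_tensor:
  fixes \<rho>1 :: "complex^3^3 \<Rightarrow> complex^'n^'n" and \<rho>2 :: "complex^3^3 \<Rightarrow> complex^'m^'m"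
  assumes "sl3_rep \<rho>1" "sl3_rep \<rho>2"
  shows "sl3_rep (tensor_rep \<rho>1 \<rho>2)"
proof -
  let ?T = "tensor_rep \<rho>1 \<rho>2"
  have add: "?T (X + Y) = ?T X + ?T Y" if "X \<in> sl3" "Y \<in> sl3" for X Y
    using assms that by (simp add: sl3_rep_def tensor_rep_def vec_eq_iff algebra_simps)
  have scale: "?T (mat c ** X) = mat c ** ?T X" if "X \<in> sl3" for X c
    using assms that by (simp add: sl3_rep_def tensor_rep_def vec_eq_iff mat_mult_left_nth algebra_simps)
  have bracket: "?T (X ** Y - Y ** X) = ?T X ** ?T Y - ?T Y ** ?T X" if XY: "X \<in> sl3" "Y \<in> sl3" for X Y
  proof -
    \<comment> \<open>The first factor acts on the columns and the second on the rows, so the two actions commute.\<close>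
    define A where "A X u = (\<chi> p. (\<rho>1 X *v (\<chi> i. u $ (i, snd p))) $ fst p)" 
      for X and u :: "complex^('n \<times> 'm)"
    define B where "B X u = (\<chi> p. (\<rho>2 X *v (\<chi> j. u $ (fst p, j))) $ snd p)" 
      for X and u :: "complex^('n \<times> 'm)"
    have T: "?T X *v u = A X u + B X u" for X u
      by (simp add: vec_eq_iff tensor_rep_apply A_def B_def split_paired_all)
    have AB: "A X (B Y u) = B Y (A X u)" for X Y u
      unfolding A_def B_def 
      by (simp add: vec_eq_iff matrix_vector_mult_def sum_distrib_left split_paired_all, subst sum.swap)
         (simp add: mult.left_commute)
    have lin: "A X (u + w) = A X u + A X w" "B X (u + w) = B X u + B X w" for X u w
      by (simp_all add: A_def B_def vec_eq_iff matrix_vector_mult_def distrib_left sum.distrib)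
    have Ab: "A (X ** Y - Y ** X) u = A X (A Y u) - A Y (A X u)" for u
    proof -
      have 1: "\<rho>1 (X ** Y - Y ** X) = \<rho>1 X ** \<rho>1 Y - \<rho>1 Y ** \<rho>1 X"
        using assms(1) XY unfolding sl3_rep_def by blast
      show ?thesis unfolding A_def 1
        by (simp add: vec_eq_iff matrix_vector_mult_diff_rdistrib flip: matrix_vector_mul_assoc) 
    qed
    have Bb: "B (X ** Y - Y ** X) u = B X (B Y u) - B Y (B X u)" for u
    proof -
      have 1: "\<rho>2 (X ** Y - Y ** X) = \<rho>2 X ** \<rho>2 Y - \<rho>2 Y ** \<rho>2 X"
        using assms(2) XY unfolding sl3_rep_def by blast
      show ?thesis unfolding B_def 1
        by (simp add: vec_eq_iff matrix_vector_mult_diff_rdistrib flip: matrix_vector_mul_assoc) 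
    qed
    have "?T (X ** Y - Y ** X) *v u = (?T X ** ?T Y - ?T Y ** ?T X) *v u" for u
    proof -
      have "?T (X ** Y - Y ** X) *v u = A X (A Y u) - A Y (A X u) + (B X (B Y u) - B Y (B X u))"
        unfolding T Ab Bb ..
      also have "... = ?T X *v (?T Y *v u) - ?T Y *v (?T X *v u)"
        unfolding T lin AB by simp
      finally show ?thesis by (simp add: matrix_vector_mult_diff_rdistrib matrix_vector_mul_assoc)
    qed
    thus ?thesis by (simp add: matrix_eq)
  qed
  show ?thesis unfolding sl3_rep_def using add scale bracket by blast
qed

lemma weight_space_tensor:
  assumes "a \<in> weight_space \<rho>1 \<mu>" "b \<in> weight_space \<rho>2 \<nu>"
  shows "tensor_vec a b \<in> weight_space (tensor_rep \<rho>1 \<rho>2) (\<mu> + \<nu>)"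
  using assms by (simp add: weight_space_def tensor_rep_tensor_vec) 
    (simp add: vec_eq_iff tensor_vec_def algebra_simps)

text \<open>The map \<open>\<phi> \<otimes> 1\<close>.\<close>
definition contract :: "(complex^'n::finite \<Rightarrow> complex) \<Rightarrow> complex^('n \<times> 'm::finite) \<Rightarrow> complex^'m" where
  "contract \<phi> u = (\<chi> b. \<phi> (\<chi> a. u $ (a, b)))"

lemma contract_linear:
  assumes add: "\<And>x y. \<phi> (x + y) = \<phi> x + \<phi> y" and scale: "\<And>c x. \<phi> (c *s x) = c * \<phi> x"
  shows "contract \<phi> (u + u') = contract \<phi> u + contract \<phi> u'"
    "contract \<phi> (u - u') = contract \<phi> u - contract \<phi> u'"
    "contract \<phi> (c *s u) = c *s contract \<phi> u"
proof -
  have diff: "\<phi> (x - y) = \<phi> x - \<phi> y" for x y using add[of "x - y" y] by simp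
  have "(\<chi> a. (u + u') $ (a, b)) = (\<chi> a. u $ (a, b)) + (\<chi> a. u' $ (a, b))"
    "(\<chi> a. (u - u') $ (a, b)) = (\<chi> a. u $ (a, b)) - (\<chi> a. u' $ (a, b))"
    "(\<chi> a. (c *s u) $ (a, b)) = c *s (\<chi> a. u $ (a, b))" for b
    by (simp_all add: vec_eq_iff)
  note col = this
  show "contract \<phi> (u + u') = contract \<phi> u + contract \<phi> u'"
    unfolding contract_def col add by (simp add: vec_eq_iff)
  show "contract \<phi> (u - u') = contract \<phi> u - contract \<phi> u'"
    unfolding contract_def col diff by (simp add: vec_eq_iff)
  show "contract \<phi> (c *s u) = c *s contract \<phi> u"
    unfolding contract_def col scale by (simp add: vec_eq_iff)
qed

lemma contract_tensor_rep:
  fixes \<phi> :: "complex^'n \<Rightarrow> complex"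
  assumes add: "\<And>x y. \<phi> (x + y) = \<phi> x + \<phi> y" and scale: "\<And>c x. \<phi> (c *s x) = c * \<phi> x"
  shows "contract \<phi> (tensor_rep \<rho>1 \<rho>2 X *v u) = contract (\<lambda>x. \<phi> (\<rho>1 X *v x)) u + \<rho>2 X *v contract \<phi> u"
proof -
  have 0: "\<phi> 0 = 0" using scale[of 0 0] by simp
  have sum: "\<phi> (\<Sum>j\<in>S. f j) = (\<Sum>j\<in>S. \<phi> (f j))" for S and f :: "'k \<Rightarrow> complex^'n"
    by (induction S rule: infinite_finite_induct) (simp_all add: add 0)
  have "\<phi> (\<chi> a. (tensor_rep \<rho>1 \<rho>2 X *v u) $ (a, b)) = 
     \<phi> (\<rho>1 X *v (\<chi> i. u $ (i, b))) + (\<rho>2 X *v contract \<phi> u) $ b" for b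
  proof -
    have "(\<chi> a. (tensor_rep \<rho>1 \<rho>2 X *v u) $ (a, b)) = 
       \<rho>1 X *v (\<chi> i. u $ (i, b)) + (\<Sum>j\<in>UNIV. \<rho>2 X $ b $ j *s (\<chi> a. u $ (a, j)))"
      by (simp add: vec_eq_iff tensor_rep_apply) (simp add: matrix_vector_mult_def)
    thus ?thesis by (simp add: add sum scale contract_def matrix_vector_mult_def)
  qed
  thus ?thesis by (simp add: contract_def vec_eq_iff)
qed

locale tensor_pair = L1: highest_weight_module \<rho>1 v \<Lambda>1 + L2: highest_weight_module \<rho>2 w \<Lambda>2
  for \<rho>1 :: "complex^3^3 \<Rightarrow> complex^'n^'n" and v \<Lambda>1 and \<rho>2 :: "complex^3^3 \<Rightarrow> complex^'m^'m" and w \<Lambda>2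
begin

sublocale T: sl3_module "tensor_rep \<rho>1 \<rho>2"
  by unfold_locales (intro sl3_rep_tensor L1.rep L2.rep)

text \<open>When a raising operator kills \<open>u\<close>, its actions on the two factors of \<open>u\<close> are opposite.  A zero
  contraction with \<open>\<phi>\<close> therefore gives a zero contraction with every functional obtained from \<open>\<phi>\<close> by raising
  operators, and these functionals separate vectors.\<close>
lemma singular_vector_zero_if_contract_zero:
  assumes \<phi>: "L1.leading_functional \<phi>" and E: "\<And>i. T.E i u = 0" and c: "contract \<phi> u = 0"
  shows "u = 0"
proof -
  have "contract (\<lambda>x. \<phi> (foldr L1.E as x)) u = 0" for as
  proof (induction as rule: rev_induct)
    case Nil thus ?case using c by simp
  next
    case (snoc i as)
    let ?\<psi> = "\<lambda>x. \<phi> (foldr L1.E as x)"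
    have "contract ?\<psi> (T.E i u) = contract (\<lambda>x. ?\<psi> (L1.E i x)) u + L2.E i (contract ?\<psi> u)"
      by (rule contract_tensor_rep) (simp_all add: L1.E_word_linear L1.leading_functionalD[OF \<phi>])
    moreover have "contract ?\<psi> (T.E i u) = 0"
      by (simp add: E contract_def vec_eq_iff L1.E_word_linear L1.leading_functionalD(3)[OF \<phi>] flip: zero_vec_def)
    ultimately show ?case using snoc by simp
  qed
  hence "\<phi> (foldr L1.E as (\<chi> a. u $ (a, b))) = 0" for as b
    by (simp add: contract_def vec_eq_iff)
  hence "(\<chi> a. u $ (a, b)) = 0" for b by (rule L1.zero_if_E_words_vanish[OF \<phi>])
  thus ?thesis by (simp add: vec_eq_iff)
qed

lemma contract_weight:
  assumes \<phi>: "L1.leading_functional \<phi>" and u: "u \<in> weight_space (tensor_rep \<rho>1 \<rho>2) \<mu>"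
  shows "contract \<phi> u \<in> weight_space \<rho>2 (\<mu> - \<Lambda>1)"
proof -
  note \<phi>' = L1.leading_functionalD[OF \<phi>]
  have "L2.H i (contract \<phi> u) = of_int ((\<mu> - \<Lambda>1) $ i) *s contract \<phi> u" for i
  proof -
    have sc: "contract \<phi> (c *s u) = c *s contract \<phi> u" for c
      by (rule contract_linear) (simp_all add: \<phi>')
    have "contract \<phi> (T.H i u) = contract (\<lambda>x. \<phi> (L1.H i x)) u + L2.H i (contract \<phi> u)"
      by (rule contract_tensor_rep) (simp_all add: \<phi>')
    moreover have "contract (\<lambda>x. \<phi> (L1.H i x)) u = of_int (\<Lambda>1 $ i) *s contract \<phi> u"
      by (simp add: \<phi>' contract_def vec_eq_iff)
    moreover have "T.H i u = of_int (\<mu> $ i) *s u" using u by (simp add: weight_space_def)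
    ultimately show ?thesis by (simp add: sc vec.scale_left_diff_distrib)
  qed
  thus ?thesis by (simp add: weight_space_def)
qed

end

section \<open>The line of singular vectors\<close>

lemma tensor_vec_linear:
  "tensor_vec (a + a') b = tensor_vec a b + tensor_vec a' b" "tensor_vec (c *s a) b = c *s tensor_vec a b"
  "tensor_vec a (b + b') = tensor_vec a b + tensor_vec a b'" "tensor_vec a (c *s b) = c *s tensor_vec a b"
  "tensor_vec 0 b = 0" "tensor_vec a 0 = 0"
  by (simp_all add: tensor_vec_def vec_eq_iff algebra_simps)

lemma contract_tensor_vec:
  assumes "\<And>c x. \<phi> (c *s x) = c * \<phi> x"
  shows "contract \<phi> (tensor_vec a b) = \<phi> a *s b"
proof -
  have "(\<chi> i. tensor_vec a b $ (i, j)) = b $ j *s a" for j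
    by (simp add: tensor_vec_def vec_eq_iff)
  thus ?thesis by (simp only: contract_def assms) (simp add: vec_eq_iff)
qed

locale gaudin_pair = tensor_pair \<rho>1 v "vector [int m1, int m2]" \<rho>2 w "vector [int k, 0]"
  for \<rho>1 :: "complex^3^3 \<Rightarrow> complex^'n^'n" and v and m1 m2 :: nat
    and \<rho>2 :: "complex^3^3 \<Rightarrow> complex^'m^'m" and w and k :: nat +
  assumes m1: "m1 \<ge> 1" and m2: "m2 \<ge> 1" and k: "k \<ge> 2"
begin

abbreviation "\<Lambda>1 \<equiv> vector [int m1, int m2] :: int^2"
abbreviation "\<Lambda>2 \<equiv> vector [int k, 0] :: int^2"
abbreviation "\<mu> \<equiv> \<Lambda>1 + \<Lambda>2 - 2 *s simple_root 1 - simple_root 2"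

lemma F2_w: "L2.F 2 w = 0"
  by (rule L2.F_v_zero) simp

text \<open>The coefficients come from solving \<open>E 1 u = E 2 u = 0\<close> from the last term upwards.  The
  last coefficient is normalized to \<open>d * m * n\<close>, which clears all denominators.\<close>
definition singular_vector :: "complex^('n \<times> 'm)" where
  "singular_vector = (let m = of_nat m1; n = of_nat m2; \<kappa> = of_nat k; d = m + n + 1 in
     (- \<kappa> * (\<kappa> - 1) * (n + 1)) *s tensor_vec (L1.F 1 (L1.F 1 (L1.F 2 v))) w
   + (\<kappa> * (\<kappa> - 1) * n) *s tensor_vec (L1.F 1 (L1.F 2 (L1.F 1 v))) w
   + ((\<kappa> - 1) * m * (n + 2)) *s tensor_vec (L1.F 1 (L1.F 2 v)) (L2.F 1 w)
   + (- (\<kappa> - 1) * n * (m - 1)) *s tensor_vec (L1.F 2 (L1.F 1 v)) (L2.F 1 w)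
   + (- d * m) *s tensor_vec (L1.F 2 v) (L2.F 1 (L2.F 1 w))
   + (- d * (\<kappa> - 1) * n) *s tensor_vec (L1.F 1 v) (L2.F 2 (L2.F 1 w))
   + (d * m * n) *s tensor_vec v (L2.F 1 (L2.F 2 (L2.F 1 w))))"

lemmas L1_eqs = L1.E_F L1.H_F L1.H_v L1.E_v simple_root_nth
lemmas L2_eqs = L2.E_F L2.H_F L2.H_v L2.E_v F2_w simple_root_nth

lemma E_L1:
  "L1.E 1 (L1.F 1 v) = of_nat m1 *s v" "L1.E 2 (L1.F 1 v) = 0"
  "L1.E 1 (L1.F 2 v) = 0" "L1.E 2 (L1.F 2 v) = of_nat m2 *s v"
  "L1.E 1 (L1.F 1 (L1.F 2 v)) = (of_nat m1 + 1) *s L1.F 2 v"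
  "L1.E 2 (L1.F 1 (L1.F 2 v)) = of_nat m2 *s L1.F 1 v"
  "L1.E 1 (L1.F 2 (L1.F 1 v)) = of_nat m1 *s L1.F 2 v"
  "L1.E 2 (L1.F 2 (L1.F 1 v)) = (of_nat m2 + 1) *s L1.F 1 v"
  "L1.E 1 (L1.F 1 (L1.F 1 (L1.F 2 v))) = (2 * of_nat m1) *s L1.F 1 (L1.F 2 v)"
  "L1.E 2 (L1.F 1 (L1.F 1 (L1.F 2 v))) = of_nat m2 *s L1.F 1 (L1.F 1 v)"
  "L1.E 1 (L1.F 1 (L1.F 2 (L1.F 1 v))) = of_nat m1 *s L1.F 1 (L1.F 2 v) + (of_nat m1 - 1) *s L1.F 2 (L1.F 1 v)"
  "L1.E 2 (L1.F 1 (L1.F 2 (L1.F 1 v))) = (of_nat m2 + 1) *s L1.F 1 (L1.F 1 v)"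
  by (simp_all add: L1_eqs mv_linear vec.scale_left_diff_distrib vec.scale_left_distrib two_distinct)
     (simp_all add: vec_eq_iff algebra_simps)

lemma E_L2:
  "L2.E 1 (L2.F 1 w) = of_nat k *s w" "L2.E 2 (L2.F 1 w) = 0"
  "L2.E 1 (L2.F 1 (L2.F 1 w)) = (2 * (of_nat k - 1)) *s L2.F 1 w" "L2.E 2 (L2.F 1 (L2.F 1 w)) = 0"
  "L2.E 1 (L2.F 2 (L2.F 1 w)) = 0" "L2.E 2 (L2.F 2 (L2.F 1 w)) = L2.F 1 w"
  "L2.E 1 (L2.F 1 (L2.F 2 (L2.F 1 w))) = (of_nat k - 1) *s L2.F 2 (L2.F 1 w)"
  "L2.E 2 (L2.F 1 (L2.F 2 (L2.F 1 w))) = L2.F 1 (L2.F 1 w)"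
  by (simp_all add: L2_eqs mv_linear vec.scale_left_diff_distrib vec.scale_left_distrib two_distinct)
     (simp_all add: vec_eq_iff algebra_simps)

lemma E_singular_vector: "T.E 1 singular_vector = 0" "T.E 2 singular_vector = 0"
  unfolding singular_vector_def Let_def
  by (simp_all only: mv_linear tensor_rep_tensor_vec E_L1 E_L2 L1.E_v L2.E_v tensor_vec_linear)
     (simp_all add: vec_eq_iff algebra_simps)

lemma singular_vector_weight: "singular_vector \<in> weight_space (tensor_rep \<rho>1 \<rho>2) \<mu>"
proof -
  have a: "L1.word as \<in> weight_space \<rho>1 (\<Lambda>1 - sum_list (map simple_root as))" for as by (rule L1.word_weight)
  have b: "L2.word bs \<in> weight_space \<rho>2 (\<Lambda>2 - sum_list (map simple_root bs))" for bs by (rule L2.word_weight)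
  have t: "tensor_vec (L1.word as) (L2.word bs) \<in> weight_space (tensor_rep \<rho>1 \<rho>2) \<mu>"
    if "sum_list (map simple_root as) + sum_list (map simple_root bs) = 2 *s simple_root 1 + simple_root 2" for as bs
  proof -
    have "(\<Lambda>1 - sum_list (map simple_root as)) + (\<Lambda>2 - sum_list (map simple_root bs)) 
        = \<Lambda>1 + \<Lambda>2 - (sum_list (map simple_root as) + sum_list (map simple_root bs))" by (simp add: algebra_simps)
    also have "... = \<mu>" unfolding that by (simp add: algebra_simps)
    finally have e: "(\<Lambda>1 - sum_list (map simple_root as)) + (\<Lambda>2 - sum_list (map simple_root bs)) = \<mu>" .
    show ?thesis using weight_space_tensor[OF a b, of as bs] unfolding e .
  qed
  have 2: "2 *s simple_root 1 = simple_root 1 + simple_root 1" by (simp add: vec_eq_iff)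
  have
    "tensor_vec (L1.F 1 (L1.F 1 (L1.F 2 v))) w \<in> weight_space (tensor_rep \<rho>1 \<rho>2) \<mu>"
    "tensor_vec (L1.F 1 (L1.F 2 (L1.F 1 v))) w \<in> weight_space (tensor_rep \<rho>1 \<rho>2) \<mu>"
    "tensor_vec (L1.F 1 (L1.F 2 v)) (L2.F 1 w) \<in> weight_space (tensor_rep \<rho>1 \<rho>2) \<mu>"
    "tensor_vec (L1.F 2 (L1.F 1 v)) (L2.F 1 w) \<in> weight_space (tensor_rep \<rho>1 \<rho>2) \<mu>"
    "tensor_vec (L1.F 2 v) (L2.F 1 (L2.F 1 w)) \<in> weight_space (tensor_rep \<rho>1 \<rho>2) \<mu>"
    "tensor_vec (L1.F 1 v) (L2.F 2 (L2.F 1 w)) \<in> weight_space (tensor_rep \<rho>1 \<rho>2) \<mu>"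
    "tensor_vec v (L2.F 1 (L2.F 2 (L2.F 1 w))) \<in> weight_space (tensor_rep \<rho>1 \<rho>2) \<mu>"
    using t[of "[1,1,2]" "[]"] t[of "[1,2,1]" "[]"] t[of "[1,2]" "[1]"] t[of "[2,1]" "[1]"]
      t[of "[2]" "[1,1]"] t[of "[1]" "[2,1]"] t[of "[]" "[1,2,1]"]
    unfolding 2 by (simp_all add: add_ac)
  thus ?thesis unfolding singular_vector_def Let_def
    by (intro vec.subspace_add[OF T.subspace_weight_space] vec.subspace_scale[OF T.subspace_weight_space])
qed

lemma singular_vector_Sing: "singular_vector \<in> Sing (tensor_rep \<rho>1 \<rho>2) \<mu>"
  using singular_vector_weight T.n_plus_kills[OF E_singular_vector] by (simp add: Sing_def)

text \<open>Only the last term survives, because \<open>\<phi>\<close> kills the images of \<open>F 1\<close> and \<open>F 2\<close>.\<close>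
lemma contract_singular_vector:
  assumes \<phi>: "L1.leading_functional \<phi>"
  shows "contract \<phi> singular_vector \<noteq> 0"
proof -
  note \<phi>' = L1.leading_functionalD[OF \<phi>]
  let ?z = "L2.F 1 (L2.F 2 (L2.F 1 w))"
  let ?c = "(of_nat m1 + of_nat m2 + 1) * of_nat m1 * of_nat m2 :: complex"
  note lin = contract_linear[of \<phi>, OF \<phi>'(1,2)] contract_tensor_vec[of \<phi>, OF \<phi>'(2)]
  have "contract \<phi> singular_vector = ?c *s ?z"
    unfolding singular_vector_def Let_def by (simp only: lin \<phi>') simp
  moreover have "?c = of_nat ((m1 + m2 + 1) * m1 * m2)" by (simp only: of_nat_mult of_nat_add of_nat_1)
  hence "?c \<noteq> 0" using m1 m2 by (simp only: of_nat_eq_0_iff) simp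
  moreover have "?z \<noteq> 0"
  proof
    assume "?z = 0"
    hence "L2.E 1 (L2.E 2 (L2.E 1 ?z)) = 0" by (simp add: mv_linear)
    hence "((of_nat k - 1) * of_nat k) *s w = 0" by (auto simp: E_L2 mv_linear)
    moreover have "(of_nat k - 1) * of_nat k = (of_nat ((k - 1) * k) :: complex)" using k by (simp add: of_nat_diff)
    hence "(of_nat k - 1) * of_nat k \<noteq> (0 :: complex)" using k by (simp only: of_nat_eq_0_iff) simp
    ultimately show False using L2.v_nz by simp
  qed
  ultimately show ?thesis by simp
qed

text \<open>Contraction with a leading functional maps the singular vectors injectively into the line of
  weight \<open>\<Lambda>2 - 2 \<alpha>\<^sub>1 - \<alpha>\<^sub>2\<close> in the second factor.\<close>
lemma Sing_eq_span: "Sing (tensor_rep \<rho>1 \<rho>2) \<mu> = vec.span {singular_vector}"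
proof
  have "vec.subspace (Sing (tensor_rep \<rho>1 \<rho>2) \<mu>)"
    using T.subspace_weight_space[of \<mu>] by (auto simp: Sing_def vec.subspace_def mv_linear)
  thus "vec.span {singular_vector} \<subseteq> Sing (tensor_rep \<rho>1 \<rho>2) \<mu>"
    using singular_vector_Sing by (intro vec.span_minimal) auto
next
  obtain \<phi> where \<phi>: "L1.leading_functional \<phi>" using L1.ex_leading_functional by blast
  note \<phi>' = L1.leading_functionalD[OF \<phi>]
  let ?z = "L2.F 1 (L2.F 2 (L2.F 1 w))"
  have line: "\<exists>c. contract \<phi> u = c *s ?z" if "u \<in> Sing (tensor_rep \<rho>1 \<rho>2) \<mu>" for u
  proof -
    have "contract \<phi> u \<in> weight_space \<rho>2 (\<mu> - \<Lambda>1)"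
      using that by (intro contract_weight \<phi>) (simp add: Sing_def)
    moreover have "\<mu> - \<Lambda>1 = \<Lambda>2 - 2 *s simple_root 1 - simple_root 2" by simp
    ultimately show ?thesis by (intro L2.weight_vector_depth_21 F2_w) simp
  qed
  obtain c0 where c0: "contract \<phi> singular_vector = c0 *s ?z" using line[OF singular_vector_Sing] by blast
  have c0nz: "c0 \<noteq> 0" using contract_singular_vector[OF \<phi>] c0 by auto
  show "Sing (tensor_rep \<rho>1 \<rho>2) \<mu> \<subseteq> vec.span {singular_vector}"
  proof
    fix u assume u: "u \<in> Sing (tensor_rep \<rho>1 \<rho>2) \<mu>"
    then obtain c where c: "contract \<phi> u = c *s ?z" using line by blast
    have "u - (c / c0) *s singular_vector = 0"
    proof (rule singular_vector_zero_if_contract_zero[OF \<phi>])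
      show "T.E i (u - (c / c0) *s singular_vector) = 0" for i
        using u singular_vector_Sing chevalley_E_n_plus[of i] by (simp add: Sing_def mv_linear)
      have "contract \<phi> (u - (c / c0) *s singular_vector) = contract \<phi> u - (c / c0) *s contract \<phi> singular_vector"
        by (simp only: contract_linear[of \<phi>, OF \<phi>'(1,2)])
      thus "contract \<phi> (u - (c / c0) *s singular_vector) = 0" using c c0 c0nz by simp
    qed
    hence "u = (c / c0) *s singular_vector" by simp
    thus "u \<in> vec.span {singular_vector}" by (metis vec.span_base vec.span_scale singletonI)
  qed
qed

lemma dim_Sing: "vec.dim (Sing (tensor_rep \<rho>1 \<rho>2) \<mu>) = 1"
proof -
  obtain \<phi> where \<phi>: "L1.leading_functional \<phi>" using L1.ex_leading_functional by blast
  have "contract \<phi> 0 = 0" using L1.leading_functionalD(3)[OF \<phi>] by (simp add: contract_def vec_eq_iff flip: zero_vec_def)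
  hence "singular_vector \<noteq> 0" using contract_singular_vector[OF \<phi>] by auto
  thus ?thesis unfolding Sing_eq_span by (simp add: vec.dim_span vec.dim_singleton)
qed

end

section \<open>The theorem\<close>

theorem mainTheorem1:
  fixes m1 m2 k :: nat
    and \<Lambda>1 \<Lambda>2 \<mu> :: "int^2"
  assumes "consistent m1 m2 2 1 k"
    and "(2 * int m1 + int m2)\<^sup>2 + int k * (4 * int m1 - (int m2)\<^sup>2) = 0"
    and "\<Lambda>1 = vector [int m1, int m2]"
    and "\<Lambda>2 = vector [int k, 0]"
    and "\<mu> = \<Lambda>1 + \<Lambda>2 - 2 *s simple_root 1 - simple_root 2"
  shows
    "(\<forall>V f0 f1 y1 y2.
        is_V_space m1 m2 2 1 k V \<and>
        f0 \<in> V \<and> lead_coeff f0 = 1 \<and> degree f0 = exp0 m1 m2 2 1 k \<and>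
        f1 \<in> V \<and> lead_coeff f1 = 1 \<and> degree f1 = exp1 m1 m2 2 1 k \<and>
        y1 = y1_poly f0 f1 \<and> y2 = y2_poly m1 m2 2 1 k f0 f1 \<longrightarrow>
        y1 = y2\<^sup>2 \<and> \<not> roots_form_bethe_solution m1 m2 k y1 y2) \<and>
     (\<nexists>t1 t2 s. bethe_solution m1 m2 k t1 t2 s) \<and>
     (\<forall>(\<rho>1 :: complex^3^3 \<Rightarrow> complex^'n^'n) v1 (\<rho>2 :: complex^3^3 \<Rightarrow> complex^'m^'m) v2.
        is_L \<Lambda>1 \<rho>1 v1 \<and> is_L \<Lambda>2 \<rho>2 v2 \<longrightarrow>
        vec.dim (Sing (tensor_rep \<rho>1 \<rho>2) \<mu>) = 1 \<and>
        (\<nexists>u. is_bethe_vector m1 m2 k \<rho>1 v1 \<rho>2 v2 u \<and>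
             vec.span {u} = Sing (tensor_rep \<rho>1 \<rho>2) \<mu>))"
proof (intro conjI)
  have par: "m1 \<ge> 1" "m2 \<ge> 1" "k \<ge> 2" using assms(1) by (auto simp: consistent_def)
  show none: "\<nexists>t1 t2 s. bethe_solution m1 m2 k t1 t2 s"
    using no_bethe_solution par assms(2) by blast
  show "\<forall>V f0 f1 y1 y2.
        is_V_space m1 m2 2 1 k V \<and>
        f0 \<in> V \<and> lead_coeff f0 = 1 \<and> degree f0 = exp0 m1 m2 2 1 k \<and>
        f1 \<in> V \<and> lead_coeff f1 = 1 \<and> degree f1 = exp1 m1 m2 2 1 k \<and>
        y1 = y1_poly f0 f1 \<and> y2 = y2_poly m1 m2 2 1 k f0 f1 \<longrightarrow>
        y1 = y2\<^sup>2 \<and> \<not> roots_form_bethe_solution m1 m2 k y1 y2"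
  proof (intro allI impI)
    fix V f0 f1 y1 y2
    assume *: "is_V_space m1 m2 2 1 k V \<and>
        f0 \<in> V \<and> lead_coeff f0 = 1 \<and> degree f0 = exp0 m1 m2 2 1 k \<and>
        f1 \<in> V \<and> lead_coeff f1 = 1 \<and> degree f1 = exp1 m1 m2 2 1 k \<and>
        y1 = y1_poly f0 f1 \<and> y2 = y2_poly m1 m2 2 1 k f0 f1"
    hence "degree f0 = 2" "degree f1 = m1 + k" by (simp_all add: exp0_def exp1_def)
    hence "f0 = (y2_poly m1 m2 2 1 k f0 f1)\<^sup>2"
      using * by (intro f0_eq_y2_square[OF par assms(2)]) auto
    thus "y1 = y2\<^sup>2 \<and> \<not> roots_form_bethe_solution m1 m2 k y1 y2"
      using * none unfolding roots_form_bethe_solution_def y1_poly_def by blast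
  qed
  show "\<forall>(\<rho>1 :: complex^3^3 \<Rightarrow> complex^'n^'n) v1 (\<rho>2 :: complex^3^3 \<Rightarrow> complex^'m^'m) v2.
        is_L \<Lambda>1 \<rho>1 v1 \<and> is_L \<Lambda>2 \<rho>2 v2 \<longrightarrow>
        vec.dim (Sing (tensor_rep \<rho>1 \<rho>2) \<mu>) = 1 \<and>
        (\<nexists>u. is_bethe_vector m1 m2 k \<rho>1 v1 \<rho>2 v2 u \<and>
             vec.span {u} = Sing (tensor_rep \<rho>1 \<rho>2) \<mu>)"
  proof (intro allI impI conjI)
    fix \<rho>1 :: "complex^3^3 \<Rightarrow> complex^'n^'n" and v1 and \<rho>2 :: "complex^3^3 \<Rightarrow> complex^'m^'m" and v2
    assume L: "is_L \<Lambda>1 \<rho>1 v1 \<and> is_L \<Lambda>2 \<rho>2 v2"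
    interpret gaudin_pair \<rho>1 v1 m1 m2 \<rho>2 v2 k
      using L par unfolding assms(3,4) by unfold_locales auto
    show "vec.dim (Sing (tensor_rep \<rho>1 \<rho>2) \<mu>) = 1"
      using dim_Sing unfolding assms(3-5) .
    show "\<nexists>u. is_bethe_vector m1 m2 k \<rho>1 v1 \<rho>2 v2 u \<and>
             vec.span {u} = Sing (tensor_rep \<rho>1 \<rho>2) \<mu>"
      using none unfolding is_bethe_vector_def by blast
  qed
qed

end
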